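(* $$\Sigma^2_{\mathcal B}<\min(0.9,\,\Sigma^2),$$ where $\Sigma^2_{\mathcal B}=\sup_{\|b\|_{\mathcal B}\le1}\sigma^2(b)$ and $\Sigma^2=\sup_{\|\mu\|_\infty\le1}\sigma^2(P\mu)$, the latter supremum being over $\mu\in L^\infty(\mathbb D)$ with $\|\mu\|_\infty\le 1$.
   Context: $\mathbb D$ is the open unit disk in $\mathbb C$. The Bloch space $\mathcal B$ consists of the analytic functions $b$ on $\mathbb D$ with $\|b\|_{\mathcal B}:=\sup_{z\in\mathbb D}(1-|z|^2)|b'(z)|<\infty$. The asymptotic variance of $b\in\mathcal B$ is $$\sigma^2(b)=\limsup_{r\to1^-}\frac{1}{2\pi|\log(1-r)|}\int_{|z|=r}|b(z)|^2\,|dz|,$$ with $|dz|$ arc length. The Bergman projection is $$P\mu(z)=\frac1\pi\int_{\mathbb D}\frac{\mu(w)}{(1-z\overline w)^2}\,|dw|^2,\qquad \mu\in L^\infty(\mathbb D),\ z\in\mathbb D,$$ where $|dw|^2$ is Lebesgue area measure; it maps $L^\infty(\mathbb D)$ into $\mathcal B$. *)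

theory Defs
  imports "HOL-Complex_Analysis.Complex_Analysis" "HOL-Probability.Essential_Supremum"
begin

abbreviation unit_disk :: "complex set" where
  "unit_disk \<equiv> ball 0 1"

text \<open>Suprema and limits superior are taken in the extended reals, so no boundedness
  has to be known beforehand.\<close>

definition bloch_norm :: "(complex \<Rightarrow> complex) \<Rightarrow> ereal" where
  "bloch_norm b = (SUP z\<in>unit_disk. ereal ((1 - (norm z)\<^sup>2) * norm (deriv b z)))"

definition bloch_space :: "(complex \<Rightarrow> complex) set" where
  "bloch_space = {b. b holomorphic_on unit_disk \<and> bloch_norm b < \<infinity>}"

definition arc_length_integral :: "(real \<Rightarrow> complex) \<Rightarrow> (complex \<Rightarrow> real) \<Rightarrow> real" where
  "arc_length_integral \<gamma> f =
     integral {0..1} (\<lambda>t. f (\<gamma> t) * norm (vector_derivative \<gamma> (at t)))"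

definition asymptotic_variance :: "(complex \<Rightarrow> complex) \<Rightarrow> ereal" where
  "asymptotic_variance b = Limsup (at_left 1) (\<lambda>r::real.
     ereal (1 / (2 * pi * \<bar>ln (1 - r)\<bar>) *
       arc_length_integral (circlepath 0 r) (\<lambda>z. (norm (b z))\<^sup>2)))"

definition Linfty_norm :: "(complex \<Rightarrow> complex) \<Rightarrow> ereal" where
  "Linfty_norm \<mu> = esssup (lebesgue_on unit_disk) (\<lambda>w. ereal (norm (\<mu> w)))"

text \<open>Elements of this set are representatives; their values off the disk are irrelevant.\<close>

definition Linfty_space :: "(complex \<Rightarrow> complex) set" where
  "Linfty_space = {\<mu>. \<mu> \<in> borel_measurable (lebesgue_on unit_disk) \<and> Linfty_norm \<mu> < \<infinity>}"

definition bergman_projection :: "(complex \<Rightarrow> complex) \<Rightarrow> complex \<Rightarrow> complex" where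
  "bergman_projection \<mu> z =
     1 / of_real pi * (\<integral>w. \<mu> w / (1 - z * cnj w)\<^sup>2 \<partial>lebesgue_on unit_disk)"

definition Sigma2_Bloch :: ereal where
  "Sigma2_Bloch = (SUP b\<in>{b \<in> bloch_space. bloch_norm b \<le> 1}. asymptotic_variance b)"

definition Sigma2 :: ereal where
  "Sigma2 = (SUP \<mu>\<in>{\<mu> \<in> Linfty_space. Linfty_norm \<mu> \<le> 1}.
     asymptotic_variance (bergman_projection \<mu>))"

end

theory Submission
  imports Defs "HOL-Real_Asymp.Real_Asymp"
begin

text \<open>Let \<open>b\<close> have Bloch norm at most 1. At a point \<open>w\<close> let \<open>m\<close> and \<open>n\<close> be the first and second
  derivatives at 0 of \<open>b \<circ> \<phi>\<close>, where \<open>\<phi>\<close> is the disk automorphism taking 0 to \<open>w\<close>. Then \<open>|m| \<le> 1\<close>,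
  and Schwarz--Pick on a small disk shows that \<open>n\<close> is small where \<open>|m|\<close> is close to 1.

  The hyperbolic Laplacian of \<open>|m|\<^sup>2\<close> is a multiple of \<open>|n|\<^sup>2 - 2 |m|\<^sup>2\<close>, which therefore has mean zero up to
  boundary terms. As \<open>|m|\<^sup>2 + 0.095 (|n|\<^sup>2 - 2 |m|\<^sup>2) \<le> 0.885\<close> pointwise, the asymptotic variance, which is
  the hyperbolic mean of \<open>|m|\<^sup>2\<close>, is at most 0.885.

  For the comparison with the Bergman projection, \<open>P m\<close> agrees with \<open>b(z)/z\<close> up to the factors
  \<open>(n+1)/(n+2)\<close> on the Taylor coefficients, and \<open>P\<close> kills \<open>\<partial>\<Phi>/\<partial>w\<close> whenever \<open>\<Phi>\<close> vanishes on the circle.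
  Taking \<open>\<Phi>\<close> to be a small multiple of \<open>(1 - |w|\<^sup>2) m\<^sup>2 cnj n\<close> changes \<open>m\<close> into a density bounded by some
  \<open>q < 1\<close> with the same projection. So every \<open>\<sigma>\<^sup>2(b)\<close> is at most \<open>q \<Sigma>\<^sup>2\<close>, and a lacunary
  series shows that \<open>\<Sigma>\<^sup>2 > 0\<close>.\<close>

subsection \<open>Stokes' theorem on the disk\<close>

text \<open>Two constraints compete: mean zero of \<open>|n|^2 - 2 |m|^2\<close> makes
  \<open>|n|^2\<close> average twice \<open>|m|^2\<close>, while \<open>n\<close> is small where
  \<open>|m|\<close> is near 1. Hence \<open>|m|\<close> cannot stay near its bound, and 0.095 acts
  as a Lagrange multiplier for the constraint. The density \<open>m\<close> alone gives only the
  weak inequality between the two suprema, since its norm may be 1. Strictness needs one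
  \<open>q\<close> for all \<open>b\<close>; this is why the correction is bounded with explicit
  constants. Integration by parts meets functions that vanish like \<open>1 - |w|^2\<close> on the
  circle but need not be smooth up to it, so it is carried out along chords with an improper
  fundamental theorem of calculus. By Parseval, circle means are power series in
  \<open>t = |z|^2\<close>, and the double integration becomes two monotonicity arguments in
  \<open>t\<close>.\<close>

lemma Complex_measurable: "(\<lambda>(x, y). Complex x y) \<in> borel_measurable (lborel \<Otimes>\<^sub>M lborel)"
  by (simp add: lborel_prod, rule borel_measurable_continuous_onI)
    (auto simp: case_prod_unfold Complex_eq intro!: continuous_intros)

text \<open>A complex box is a product of real intervals, and the measure of boxes determines
  \<open>lborel\<close>. This gives Fubini's theorem on the disk in both orders.\<close>

lemma lborel_complex: "(lborel :: complex measure) = distr (lborel \<Otimes>\<^sub>M lborel) borel (\<lambda>(x, y). Complex x y)"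
proof (rule lborel_eqI)
  fix l u :: complex
  assume *: "\<And>b. b \<in> Basis \<Longrightarrow> l \<bullet> b \<le> u \<bullet> b"
  have le: "Re l \<le> Re u" "Im l \<le> Im u"
    using *[of 1] *[of \<i>] by (auto simp: Basis_complex_def)
  have "(\<lambda>(x, y). Complex x y) -` box l u \<inter> space (lborel \<Otimes>\<^sub>M lborel) = box (Re l) (Re u) \<times> box (Im l) (Im u)"
    by (auto simp: box_def Basis_complex_def space_pair_measure)
  then show "emeasure (distr (lborel \<Otimes>\<^sub>M lborel) borel (\<lambda>(x, y). Complex x y)) (box l u) = (\<Prod>b\<in>Basis. (u - l) \<bullet> b)"
    using le by (subst emeasure_distr[OF Complex_measurable])
      (auto simp: lborel.emeasure_pair_measure_Times Basis_complex_def ennreal_mult)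
qed auto

text \<open>Nothing is assumed about \<open>h\<close> at the endpoints themselves: its bound forces
  one-sided limits 0 there, boundedness makes \<open>f\<close> integrable, and the improper
  fundamental theorem of calculus applies.\<close>

lemma integral_deriv_eq_0_if_vanishes_at_endpoints:
  fixes h f :: "real \<Rightarrow> complex"
  assumes s: "0 < s"
    and h: "\<And>x. \<bar>x\<bar> < s \<Longrightarrow> (h has_vector_derivative f x) (at x)"
    and f: "continuous_on {-s<..<s} f"
    and K: "\<And>x. \<bar>x\<bar> < s \<Longrightarrow> norm (f x) \<le> K"
    and L: "\<And>x. \<bar>x\<bar> < s \<Longrightarrow> norm (h x) \<le> L * (s\<^sup>2 - x\<^sup>2)"
  shows "(LINT x|lborel. indicator {-s<..<s} x *\<^sub>R f x) = 0"
proof -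
  have "set_integrable lborel {-s<..<s} f"
  proof (rule set_integrable_bound[where f = "\<lambda>_. K"])
    show "set_integrable lborel {-s<..<s} (\<lambda>_. K)"
      using s by (simp add: set_integrable_def integrable_real_indicator)
    show "set_borel_measurable lborel {-s<..<s} f"
      using f by (simp add: set_borel_measurable_def borel_measurable_continuous_on_indicator)
    show "AE x in lborel. x \<in> {-s<..<s} \<longrightarrow> norm (f x) \<le> norm K"
      using K by (intro AE_I2) (fastforce intro: order_trans[OF _ abs_ge_self])
  qed
  moreover have "(h \<longlongrightarrow> 0) (at_right (-s))" "(h \<longlongrightarrow> 0) (at_left s)"
  proof -
    have "((\<lambda>x. L * (s\<^sup>2 - x\<^sup>2)) \<longlongrightarrow> L * (s\<^sup>2 - (-s)\<^sup>2)) (at_right (-s))"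
      by (intro tendsto_intros)
    then have *: "((\<lambda>x. L * (s\<^sup>2 - x\<^sup>2)) \<longlongrightarrow> 0) (at_right (-s))" by simp
    have "((\<lambda>x. L * (s\<^sup>2 - x\<^sup>2)) \<longlongrightarrow> L * (s\<^sup>2 - s\<^sup>2)) (at_left s)"
      by (intro tendsto_intros)
    then have **: "((\<lambda>x. L * (s\<^sup>2 - x\<^sup>2)) \<longlongrightarrow> 0) (at_left s)" by simp
    have e1: "\<forall>\<^sub>F x in at_right (-s). norm (h x) \<le> L * (s\<^sup>2 - x\<^sup>2)"
      using s by (intro eventually_at_rightI[of _ s]) (auto intro!: L)
    have e2: "\<forall>\<^sub>F x in at_left s. norm (h x) \<le> L * (s\<^sup>2 - x\<^sup>2)"
      using s by (intro eventually_at_leftI[of "-s"]) (auto intro!: L)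
    show "(h \<longlongrightarrow> 0) (at_right (-s))" by (rule Lim_null_comparison[OF e1 *])
    show "(h \<longlongrightarrow> 0) (at_left s)" by (rule Lim_null_comparison[OF e2 **])
  qed
  moreover have "isCont f x" if "- s < x" "x < s" for x
    using continuous_on_interior[OF f] that by simp
  moreover define l where "l = -s"
  ultimately have "(LBINT x=ereal l..ereal s. f x) = 0 - 0"
    using s h by (intro interval_integral_FTC_integrable[where F = h])
      (auto simp: ereal_tendsto_simps)
  then show ?thesis
    using s unfolding l_def by (simp add: interval_lebesgue_integral_def set_lebesgue_integral_def)
qed

lemma lebesgue_on_disk_integral:
  fixes f :: "complex \<Rightarrow> complex"
  assumes f: "continuous_on unit_disk f"
  shows "integral\<^sup>L (lebesgue_on unit_disk) f = (LINT w|lborel. indicator unit_disk w *\<^sub>R f w)"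
proof -
  have "(\<lambda>w. indicator unit_disk w *\<^sub>R f w) \<in> borel_measurable lborel"
    using f by (simp add: borel_measurable_continuous_on_indicator)
  then show ?thesis
    by (subst integral_restrict_space) (auto simp: integral_completion)
qed

lemma integrable_disk_bounded:
  fixes f :: "complex \<Rightarrow> 'a :: {banach, second_countable_topology}"
  assumes "f \<in> borel_measurable (lebesgue_on unit_disk)" and "\<And>w. w \<in> unit_disk \<Longrightarrow> norm (f w) \<le> K"
  shows "integrable (lebesgue_on unit_disk) f"
proof -
  interpret finite_measure "lebesgue_on unit_disk"
    by (rule finite_measure_lebesgue_on) auto
  show ?thesis
    by (rule integrable_const_bound[of _ K]) (use assms in \<open>auto simp: space_restrict_space\<close>)
qed

lemma integrable_disk_continuous:
  fixes f :: "complex \<Rightarrow> complex"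
  assumes "continuous_on unit_disk f" and "\<And>w. w \<in> unit_disk \<Longrightarrow> norm (f w) \<le> K"
  shows "integrable (lebesgue_on unit_disk) f"
  by (rule integrable_disk_bounded[OF continuous_imp_measurable_on_sets_lebesgue]) (use assms in auto)

lemma Complex_in_unit_disk: "Complex x y \<in> unit_disk \<longleftrightarrow> x\<^sup>2 + y\<^sup>2 < 1"
  by (simp add: cmod_def)

lemma disk_integral_chords:
  fixes \<Psi> :: "complex \<Rightarrow> complex"
  assumes \<Psi>: "continuous_on unit_disk \<Psi>" and K: "\<And>w. w \<in> unit_disk \<Longrightarrow> norm (\<Psi> w) \<le> K"
  shows "integral\<^sup>L (lebesgue_on unit_disk) \<Psi> =
      (LINT y|lborel. LINT x|lborel. indicator unit_disk (Complex x y) *\<^sub>R \<Psi> (Complex x y))" (is ?A)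
    and "integral\<^sup>L (lebesgue_on unit_disk) \<Psi> =
      (LINT x|lborel. LINT y|lborel. indicator unit_disk (Complex x y) *\<^sub>R \<Psi> (Complex x y))" (is ?B)
proof -
  define F where "F = (\<lambda>w. indicator unit_disk w *\<^sub>R \<Psi> w)"
  have meas: "F \<in> borel_measurable borel"
    unfolding F_def using \<Psi> by (simp add: borel_measurable_continuous_on_indicator)
  have "integrable lborel F"
    using integrable_disk_continuous[of \<Psi> K, OF \<Psi> K, simplified] meas
    by (subst (asm) integrable_restrict_space) (auto simp: set_integrable_def F_def integrable_completion)
  then have "integrable (lborel \<Otimes>\<^sub>M lborel) (\<lambda>(x, y). F (Complex x y))"
    by (subst (asm) lborel_complex, subst (asm) integrable_distr_eq[OF Complex_measurable meas])
      (simp add: case_prod_unfold)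
  note int = this
  have "integral\<^sup>L (lebesgue_on unit_disk) \<Psi> = integral\<^sup>L lborel F"
    unfolding F_def by (rule lebesgue_on_disk_integral[OF \<Psi>])
  also have "\<dots> = integral\<^sup>L (lborel \<Otimes>\<^sub>M lborel) (\<lambda>(x, y). F (Complex x y))"
    by (subst lborel_complex, subst integral_distr[OF Complex_measurable meas])
      (simp add: case_prod_unfold)
  finally have *: "integral\<^sup>L (lebesgue_on unit_disk) \<Psi> = integral\<^sup>L (lborel \<Otimes>\<^sub>M lborel) (\<lambda>(x, y). F (Complex x y))" .
  show ?A unfolding * F_def[symmetric]
    using lborel_pair.integral_snd[OF int] F_def by simp
  show ?B unfolding * F_def[symmetric]
    using lborel_pair.integral_fst[OF int] F_def by simp
qed

lemma disk_integral_dx_eq_0: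
  fixes \<Phi> \<Psi> :: "complex \<Rightarrow> complex"
  assumes \<Psi>: "continuous_on unit_disk \<Psi>" and K: "\<And>w. w \<in> unit_disk \<Longrightarrow> norm (\<Psi> w) \<le> K"
    and L: "\<And>w. w \<in> unit_disk \<Longrightarrow> norm (\<Phi> w) \<le> L * (1 - (norm w)\<^sup>2)"
  shows "(\<And>w. w \<in> unit_disk \<Longrightarrow> ((\<lambda>x. \<Phi> (Complex x (Im w))) has_vector_derivative \<Psi> w) (at (Re w)))
      \<Longrightarrow> integral\<^sup>L (lebesgue_on unit_disk) \<Psi> = 0"
    and "(\<And>w. w \<in> unit_disk \<Longrightarrow> ((\<lambda>y. \<Phi> (Complex (Re w) y)) has_vector_derivative \<Psi> w) (at (Im w)))
      \<Longrightarrow> integral\<^sup>L (lebesgue_on unit_disk) \<Psi> = 0"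
proof -
  have iff: "x\<^sup>2 + y\<^sup>2 < 1 \<longleftrightarrow> \<bar>x\<bar> < sqrt (1 - y\<^sup>2)" for x y :: real
  proof -
    have "x\<^sup>2 + y\<^sup>2 < 1 \<longleftrightarrow> x\<^sup>2 < 1 - y\<^sup>2" by linarith
    also have "\<dots> \<longleftrightarrow> sqrt (x\<^sup>2) < sqrt (1 - y\<^sup>2)" by (rule real_sqrt_less_iff[symmetric])
    finally show ?thesis unfolding real_sqrt_abs .
  qed
  \<comment> \<open>Stated through \<open>x^2 + y^2 < 1\<close>, which is symmetric, so that it
    serves horizontal and vertical chords alike. On a chord of half-length \<open>s\<close> the
    weight \<open>1 - |w|^2\<close> becomes \<open>s^2 - x^2\<close>.\<close>
  have chord: "(LINT x|lborel. indicator {x. x\<^sup>2 + y\<^sup>2 < 1} x *\<^sub>R f x) = 0"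
    if h: "\<And>x. x\<^sup>2 + y\<^sup>2 < 1 \<Longrightarrow> (h has_vector_derivative f x) (at x)"
      and f: "continuous_on {x. x\<^sup>2 + y\<^sup>2 < 1} f"
      and Kf: "\<And>x. x\<^sup>2 + y\<^sup>2 < 1 \<Longrightarrow> norm (f x) \<le> K"
      and Lf: "\<And>x. x\<^sup>2 + y\<^sup>2 < 1 \<Longrightarrow> norm (h x) \<le> L * (1 - (x\<^sup>2 + y\<^sup>2))"
    for f h :: "real \<Rightarrow> complex" and y :: real
  proof (cases "y\<^sup>2 < 1")
    case False
    then have "{x. x\<^sup>2 + y\<^sup>2 < 1} = {}"
      using zero_le_power2 by (auto simp: not_less intro: order_trans add_increasing)
    then show ?thesis by simp
  next
    case True
    define s where "s = sqrt (1 - y\<^sup>2)"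
    have s: "0 < s" "s\<^sup>2 = 1 - y\<^sup>2" using True by (auto simp: s_def)
    have eq: "x\<^sup>2 + y\<^sup>2 < 1 \<longleftrightarrow> \<bar>x\<bar> < s" for x using iff[of x y] by (simp add: s_def)
    have seteq: "{x. x\<^sup>2 + y\<^sup>2 < 1} = {-s<..<s}" unfolding eq by auto
    show ?thesis unfolding seteq
    proof (rule integral_deriv_eq_0_if_vanishes_at_endpoints[OF s(1), where K = K and L = L and h = h])
      show "continuous_on {-s<..<s} f" using f unfolding seteq .
      fix x assume "\<bar>x\<bar> < s"
      then have x: "x\<^sup>2 + y\<^sup>2 < 1" by (simp only: eq)
      show "(h has_vector_derivative f x) (at x)" "norm (f x) \<le> K" using h[OF x] Kf[OF x] .
      have "s\<^sup>2 - x\<^sup>2 = 1 - (x\<^sup>2 + y\<^sup>2)" using s by simp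
      then show "norm (h x) \<le> L * (s\<^sup>2 - x\<^sup>2)" using Lf[OF x] by (simp only:)
    qed
  qed
  show "integral\<^sup>L (lebesgue_on unit_disk) \<Psi> = 0"
    if d: "\<And>w. w \<in> unit_disk \<Longrightarrow> ((\<lambda>x. \<Phi> (Complex x (Im w))) has_vector_derivative \<Psi> w) (at (Re w))"
  proof -
    have "(LINT x|lborel. indicator unit_disk (Complex x y) *\<^sub>R \<Psi> (Complex x y)) = 0" for y
    proof -
      have "(LINT x|lborel. indicator {x. x\<^sup>2 + y\<^sup>2 < 1} x *\<^sub>R \<Psi> (Complex x y)) = 0"
      proof (rule chord[where h = "\<lambda>x. \<Phi> (Complex x y)"])
        fix x assume "x\<^sup>2 + y\<^sup>2 < 1"
        then have w: "Complex x y \<in> unit_disk" unfolding Complex_in_unit_disk .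
        show "((\<lambda>x. \<Phi> (Complex x y)) has_vector_derivative \<Psi> (Complex x y)) (at x)"
          using d[OF w] by simp
        show "norm (\<Psi> (Complex x y)) \<le> K" by (rule K[OF w])
        show "norm (\<Phi> (Complex x y)) \<le> L * (1 - (x\<^sup>2 + y\<^sup>2))"
          using L[OF w] by (simp add: cmod_def)
      next
        show "continuous_on {x. x\<^sup>2 + y\<^sup>2 < 1} (\<lambda>x. \<Psi> (Complex x y))"
          by (rule continuous_on_compose2[OF \<Psi>])
            (auto simp only: Complex_in_unit_disk, auto simp: Complex_eq intro!: continuous_intros)
      qed
      then show ?thesis by (simp only: indicator_def mem_Collect_eq Complex_in_unit_disk)
    qed
    then show ?thesis by (subst disk_integral_chords(1)[OF \<Psi> K]) auto
  qed
  show "integral\<^sup>L (lebesgue_on unit_disk) \<Psi> = 0"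
    if d: "\<And>w. w \<in> unit_disk \<Longrightarrow> ((\<lambda>y. \<Phi> (Complex (Re w) y)) has_vector_derivative \<Psi> w) (at (Im w))"
  proof -
    have "(LINT y|lborel. indicator unit_disk (Complex x y) *\<^sub>R \<Psi> (Complex x y)) = 0" for x
    proof -
      have "(LINT y|lborel. indicator {y. y\<^sup>2 + x\<^sup>2 < 1} y *\<^sub>R \<Psi> (Complex x y)) = 0"
      proof (rule chord[where h = "\<lambda>y. \<Phi> (Complex x y)"])
        fix y assume "y\<^sup>2 + x\<^sup>2 < 1"
        then have w: "Complex x y \<in> unit_disk" unfolding Complex_in_unit_disk by simp
        show "((\<lambda>y. \<Phi> (Complex x y)) has_vector_derivative \<Psi> (Complex x y)) (at y)"
          using d[OF w] by simp
        show "norm (\<Psi> (Complex x y)) \<le> K" by (rule K[OF w])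
        show "norm (\<Phi> (Complex x y)) \<le> L * (1 - (y\<^sup>2 + x\<^sup>2))"
          using L[OF w] by (simp add: cmod_def add.commute)
      next
        show "continuous_on {y. y\<^sup>2 + x\<^sup>2 < 1} (\<lambda>y. \<Psi> (Complex x y))"
          by (rule continuous_on_compose2[OF \<Psi>])
            (auto simp only: Complex_in_unit_disk add.commute, auto simp: Complex_eq intro!: continuous_intros)
      qed
      then show ?thesis by (simp only: indicator_def mem_Collect_eq Complex_in_unit_disk add.commute)
    qed
    then show ?thesis by (subst disk_integral_chords(2)[OF \<Psi> K]) auto
  qed
qed

text \<open>\<open>A\<close> and \<open>B\<close> are the Wirtinger derivatives of \<open>f\<close> with respect to \<open>w\<close> and \<open>cnj w\<close>.\<close>

definition has_wirtinger :: "(complex \<Rightarrow> complex) \<Rightarrow> complex \<Rightarrow> complex \<Rightarrow> complex \<Rightarrow> bool" where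
  "has_wirtinger f A B w \<longleftrightarrow> (f has_derivative (\<lambda>h. A * h + B * cnj h)) (at w)"

text \<open>The partial derivatives of \<open>\<Phi>\<close> in \<open>x\<close> and
  \<open>y\<close> are \<open>A + B\<close> and \<open>\<i> * (A - B)\<close>. Both integrate to 0
  along chords, and together they determine \<open>A\<close> and \<open>B\<close>.\<close>

proposition disk_integral_wirtinger_eq_0:
  assumes d: "\<And>w. w \<in> unit_disk \<Longrightarrow> has_wirtinger \<Phi> (A w) (B w) w"
    and A: "continuous_on unit_disk A" and KA: "\<And>w. w \<in> unit_disk \<Longrightarrow> norm (A w) \<le> K"
    and B: "continuous_on unit_disk B" and KB: "\<And>w. w \<in> unit_disk \<Longrightarrow> norm (B w) \<le> K'"
    and L: "\<And>w. w \<in> unit_disk \<Longrightarrow> norm (\<Phi> w) \<le> L * (1 - (norm w)\<^sup>2)"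
  shows "integral\<^sup>L (lebesgue_on unit_disk) A = 0" and "integral\<^sup>L (lebesgue_on unit_disk) B = 0"
proof -
  have x: "integral\<^sup>L (lebesgue_on unit_disk) (\<lambda>w. A w + B w) = 0"
  proof (rule disk_integral_dx_eq_0(1)[where \<Phi> = \<Phi> and L = L and K = "K + K'"])
    fix w assume w: "w \<in> unit_disk"
    then show "norm (A w + B w) \<le> K + K'"
      by (intro norm_triangle_le add_mono KA KB)
    have "((\<lambda>x. Complex x (Im w)) has_derivative (\<lambda>h. of_real h)) (at (Re w))"
      unfolding Complex_eq by (auto intro!: derivative_eq_intros)
    from diff_chain_at[OF this, of \<Phi> "\<lambda>h. A w * h + B w * cnj h"] d[OF w]
    show "((\<lambda>x. \<Phi> (Complex x (Im w))) has_vector_derivative A w + B w) (at (Re w))"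
      by (simp add: has_wirtinger_def has_vector_derivative_def o_def algebra_simps scaleR_conv_of_real)
  qed (use A B L in \<open>auto intro!: continuous_intros\<close>)
  have y: "integral\<^sup>L (lebesgue_on unit_disk) (\<lambda>w. \<i> * (A w - B w)) = 0"
  proof (rule disk_integral_dx_eq_0(2)[where \<Phi> = \<Phi> and L = L and K = "K + K'"])
    fix w assume w: "w \<in> unit_disk"
    then show "norm (\<i> * (A w - B w)) \<le> K + K'"
      using order_trans[OF norm_triangle_ineq4 add_mono[OF KA[OF w] KB[OF w]]] by (simp add: norm_mult)
    have "((\<lambda>y. Complex (Re w) y) has_derivative (\<lambda>h. \<i> * of_real h)) (at (Im w))"
      unfolding Complex_eq by (auto intro!: derivative_eq_intros)
    from diff_chain_at[OF this, of \<Phi> "\<lambda>h. A w * h + B w * cnj h"] d[OF w]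
    show "((\<lambda>y. \<Phi> (Complex (Re w) y)) has_vector_derivative \<i> * (A w - B w)) (at (Im w))"
      by (simp add: has_wirtinger_def has_vector_derivative_def o_def algebra_simps scaleR_conv_of_real)
  qed (use A B L in \<open>auto intro!: continuous_intros\<close>)
  note iA = integrable_disk_continuous[of A K, OF A KA, simplified] and iB = integrable_disk_continuous[of B K', OF B KB, simplified]
  from x y iA iB show "integral\<^sup>L (lebesgue_on unit_disk) A = 0" "integral\<^sup>L (lebesgue_on unit_disk) B = 0"
    by auto
qed

section \<open>Rules for Wirtinger derivatives\<close>

lemma has_wirtinger_const: "has_wirtinger (\<lambda>_. c) 0 0 w"
  and has_wirtinger_id: "has_wirtinger (\<lambda>w. w) 1 0 w"
  and has_wirtinger_cnj_id: "has_wirtinger cnj 0 1 w"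
  by (auto simp: has_wirtinger_def intro!: derivative_eq_intros)

lemma has_wirtinger_diff:
  "has_wirtinger f A B w \<Longrightarrow> has_wirtinger g A' B' w \<Longrightarrow> has_wirtinger (\<lambda>w. f w - g w) (A - A') (B - B') w"
  unfolding has_wirtinger_def by (auto intro!: derivative_eq_intros simp: algebra_simps)

lemma has_wirtinger_mult:
  "has_wirtinger f A B w \<Longrightarrow> has_wirtinger g A' B' w \<Longrightarrow>
    has_wirtinger (\<lambda>w. f w * g w) (A * g w + f w * A') (B * g w + f w * B') w"
  unfolding has_wirtinger_def by (auto intro!: derivative_eq_intros simp: algebra_simps)

lemma has_wirtinger_cnj:
  "has_wirtinger f A B w \<Longrightarrow> has_wirtinger (\<lambda>w. cnj (f w)) (cnj B) (cnj A) w"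
  unfolding has_wirtinger_def by (auto intro!: derivative_eq_intros simp: algebra_simps)

lemma has_wirtinger_field: "(f has_field_derivative A) (at w) \<Longrightarrow> has_wirtinger f A 0 w"
  by (simp add: has_wirtinger_def has_field_derivative_def)

lemma has_wirtinger_power: "has_wirtinger (\<lambda>w. w ^ n) (of_nat n * w ^ (n - 1)) 0 w"
  by (rule has_wirtinger_field) (auto intro!: derivative_eq_intros)

lemma has_wirtinger_cnj_power: "has_wirtinger (\<lambda>w. cnj w ^ n) 0 (of_nat n * cnj w ^ (n - 1)) w"
  using has_wirtinger_cnj[OF has_wirtinger_power[of n w]] by simp

subsection \<open>Pointwise inequalities for Bloch functions\<close>

text \<open>Divided by \<open>|1 + cnj a * z|^2\<close>, this is the formula for
  \<open>1 - |\<phi> z|^2\<close> of a disk automorphism \<open>\<phi>\<close>. It shows that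
  \<open>\<phi>\<close> preserves the disk and that the Bloch bound is conformally
  invariant.\<close>

lemma cmod_blaschke_identity:
  "(cmod (1 + cnj a * z))\<^sup>2 - (cmod (z + a))\<^sup>2 = (1 - (cmod a)\<^sup>2) * (1 - (cmod z)\<^sup>2)"
  unfolding cmod_power2 by (simp add: power2_eq_square algebra_simps)

lemma one_plus_cnj_mult_nonzero:
  assumes "cmod a < 1" "cmod z < 1"
  shows "1 + cnj a * z \<noteq> 0"
proof
  assume "1 + cnj a * z = 0"
  then have "cmod (cnj a * z) = 1" by (metis add.commute add_eq_0_iff norm_minus_cancel norm_one)
  moreover have "cmod (cnj a * z) < 1"
    using assms by (simp add: norm_mult) (metis mult_le_one norm_ge_zero less_le mult.right_neutral mult_left_mono order_le_less_trans)
  ultimately show False by simp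
qed

lemma cmod_blaschke_less_1:
  assumes "cmod a < 1" "cmod z < 1"
  shows "cmod ((z + a) / (1 + cnj a * z)) < 1"
proof -
  have "(1 - (cmod a)\<^sup>2) * (1 - (cmod z)\<^sup>2) > 0"
    using assms by (intro mult_pos_pos) (simp_all add: power_less_one_iff)
  then have "(cmod (z + a))\<^sup>2 < (cmod (1 + cnj a * z))\<^sup>2"
    using cmod_blaschke_identity[of a z] by linarith
  then have "cmod (z + a) < cmod (1 + cnj a * z)" by (rule power2_less_imp_less) simp
  moreover have "cmod (1 + cnj a * z) > 0"
    using one_plus_cnj_mult_nonzero[OF assms] by simp
  ultimately show ?thesis by (simp add: norm_divide)
qed

text \<open>\<open>f / M\<close>, rescaled to the unit disk, is a self-map \<open>g\<close>. The
  Blaschke factor with \<open>a = - g 0\<close> moves its value at 0 to 0, and Schwarz's lemma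
  bounds the derivative of the composite \<open>h\<close>.\<close>

lemma schwarz_pick_at_0:
  assumes f: "f holomorphic_on ball 0 r" and r: "0 < r"
    and M: "\<And>z. cmod z < r \<Longrightarrow> cmod (f z) < M"
    and d: "(f has_field_derivative f') (at 0)"
  shows "r * cmod f' \<le> M - (cmod (f 0))\<^sup>2 / M"
proof -
  have M0: "M > 0" using M[of 0] r by (auto intro: order_le_less_trans[OF norm_ge_zero])
  define a where "a = - (f 0 / of_real M)"
  define g where "g = (\<lambda>z. f (of_real r * z) / of_real M)"
  define h where "h = (\<lambda>z. (g z + a) / (1 + cnj a * g z))"
  have a1: "cmod a < 1" using M[of 0] r M0 by (simp add: a_def norm_divide)
  have g1: "cmod (g z) < 1" if "cmod z < 1" for z
    using M[of "of_real r * z"] r M0 that by (simp add: g_def norm_divide norm_mult)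
  have ghol: "g holomorphic_on ball 0 1"
    unfolding g_def
    by (intro holomorphic_intros holomorphic_on_compose_gen[OF _ f, unfolded o_def])
      (use r M0 in \<open>auto simp: norm_mult\<close>)
  have dg: "(g has_field_derivative of_real r * f' / of_real M) (at 0)"
  proof -
    have "(f has_field_derivative f') (at (of_real r * 0))" using d by simp
    then have "((\<lambda>z. f (of_real r * z)) has_field_derivative f' * of_real r) (at 0)"
      by (rule DERIV_chain2) (auto intro!: derivative_eq_intros)
    from DERIV_cdivide[OF this, of "of_real M"] show ?thesis
      by (simp add: g_def mult.commute)
  qed
  have g0: "g 0 = - a" by (simp add: g_def a_def)
  have nz: "1 + cnj a * g z \<noteq> 0" if "cmod z < 1" for z
    by (rule one_plus_cnj_mult_nonzero[OF a1 g1[OF that]])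
  have h: "h holomorphic_on ball 0 1"
    unfolding h_def using nz by (intro holomorphic_intros ghol) auto
  have "cmod (deriv h 0) \<le> 1"
    by (rule Schwarz_Lemma(2)[OF h _ _ , of 0])
      (use cmod_blaschke_less_1[OF a1 g1] g0 in \<open>auto simp: h_def\<close>)
  moreover have "(h has_field_derivative (of_real r * f' / of_real M) / (1 + cnj a * g 0)) (at 0)"
  proof -
    have eq: "(of_real r * f' / of_real M) * (1 + cnj a * g 0) - (g 0 + a) * (cnj a * (of_real r * f' / of_real M))
        = (of_real r * f' / of_real M) * (1 + cnj a * g 0)" using g0 by simp
    have "((\<lambda>z. g z + a) has_field_derivative of_real r * f' / of_real M) (at 0)"
      "((\<lambda>z. 1 + cnj a * g z) has_field_derivative cnj a * (of_real r * f' / of_real M)) (at 0)"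
      by (auto intro!: derivative_eq_intros dg)
    from DERIV_divide[OF this] nz[of 0] show ?thesis
      unfolding h_def eq by simp
  qed
  then have "deriv h 0 = (of_real r * f' / of_real M) / (1 + cnj a * g 0)"
    by (rule DERIV_imp_deriv)
  moreover have "1 + cnj a * g 0 = of_real (1 - (cmod a)\<^sup>2)"
    unfolding of_real_diff complex_norm_square g0 by simp
  moreover have pos: "1 - (cmod a)\<^sup>2 > 0" using a1 by (simp add: power_less_one_iff)
  ultimately have "cmod (of_real r * f' / of_real M) / (1 - (cmod a)\<^sup>2) \<le> 1"
    by (simp only: norm_divide norm_of_real abs_of_pos)
  then have "r * cmod f' / M \<le> 1 - (cmod a)\<^sup>2"
    using pos r M0 by (simp add: norm_divide norm_mult field_simps)
  then have "r * cmod f' \<le> (1 - (cmod a)\<^sup>2) * M" using M0 by (simp add: field_simps)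
  also have "(1 - (cmod a)\<^sup>2) * M = M - (cmod (f 0))\<^sup>2 / M"
    using M0 by (simp add: a_def norm_divide power_divide field_simps power2_eq_square)
  finally show ?thesis .
qed

text \<open>Schwarz--Pick for \<open>\<zeta> \<mapsto> (b \<circ> \<phi>)'(\<zeta>)\<close> on the disk of radius \<open>r\<close>, where \<open>g = b'\<close> and \<open>\<phi>\<close> is the
  disk automorphism taking 0 to \<open>w\<close>.\<close>

lemma bloch_second_derivative_bound:
  assumes g: "g holomorphic_on unit_disk"
    and bd: "\<And>w. w \<in> unit_disk \<Longrightarrow> (1 - (cmod w)\<^sup>2) * cmod (g w) \<le> 1"
    and w: "w \<in> unit_disk" and r: "0 < r" "r < 1"
  defines "\<rho> \<equiv> 1 - (cmod w)\<^sup>2"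
  shows "r * cmod (of_real (\<rho>\<^sup>2) * deriv g w - 2 * cnj w * of_real \<rho> * g w)
    \<le> 1 / (1 - r\<^sup>2) - (1 - r\<^sup>2) * (\<rho> * cmod (g w))\<^sup>2"
proof -
  define \<phi> where "\<phi> = (\<lambda>z. (z + w) / (1 + cnj w * z))"
  \<comment> \<open>The second factor is \<open>\<phi>'\<close>, so for \<open>g = b'\<close> this
    is \<open>(b \<circ> \<phi>)'\<close>; its value and derivative at 0 are the \<open>m\<close>
    and \<open>n\<close> of the overview.\<close>
  define f where "f = (\<lambda>z. g (\<phi> z) * (of_real \<rho> / (1 + cnj w * z)\<^sup>2))"
  have w1: "cmod w < 1" using w by simp
  have \<rho>: "\<rho> > 0" using w1 by (simp add: \<rho>_def power_less_one_iff)
  have nz: "1 + cnj w * z \<noteq> 0" if "cmod z < 1" for z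
    by (rule one_plus_cnj_mult_nonzero[OF w1 that])
  have \<phi>1: "cmod (\<phi> z) < 1" if "cmod z < 1" for z
    unfolding \<phi>_def by (rule cmod_blaschke_less_1[OF w1 that])
  have \<phi>hol: "\<phi> holomorphic_on unit_disk"
    unfolding \<phi>_def using nz by (intro holomorphic_intros) auto
  have fhol: "f holomorphic_on unit_disk"
    unfolding f_def using nz \<phi>1
    by (intro holomorphic_intros holomorphic_on_compose_gen[OF \<phi>hol g, unfolded o_def]) auto
  have \<phi>sq: "1 - (cmod (\<phi> z))\<^sup>2 = \<rho> * (1 - (cmod z)\<^sup>2) / (cmod (1 + cnj w * z))\<^sup>2" if "cmod z < 1" for z
    using cmod_blaschke_identity[of w z] nz[OF that]
    by (simp add: \<phi>_def norm_divide power_divide \<rho>_def field_simps)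
  \<comment> \<open>Since \<open>(1 - |z|^2) |\<phi>' z| = 1 - |\<phi> z|^2\<close>,
    \<open>f\<close> inherits the Bloch bound. On \<open>|z| < r\<close> it supplies the constant
    \<open>M = 1 / (1 - r^2)\<close> for Schwarz--Pick.\<close>
  have fbd: "(1 - (cmod z)\<^sup>2) * cmod (f z) \<le> 1" if "cmod z < 1" for z
  proof -
    have "(1 - (cmod z)\<^sup>2) * cmod (f z) = (1 - (cmod (\<phi> z))\<^sup>2) * cmod (g (\<phi> z))"
      unfolding \<phi>sq[OF that] f_def using \<rho> by (simp add: norm_mult norm_divide norm_power)
    also have "\<dots> \<le> 1" using \<phi>1[OF that] by (intro bd) simp
    finally show ?thesis .
  qed
  have r2: "0 < 1 - r\<^sup>2" using r by (simp add: power_less_one_iff)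
  have M: "cmod (f z) < 1 / (1 - r\<^sup>2)" if z: "cmod z < r" for z
  proof -
    have "(cmod z)\<^sup>2 < r\<^sup>2" using z by (intro power_strict_mono) auto
    then have lt: "1 - r\<^sup>2 < 1 - (cmod z)\<^sup>2" by simp
    have "cmod (f z) \<le> 1 / (1 - (cmod z)\<^sup>2)"
      using fbd[of z] z r lt r2 by (simp add: field_simps)
    also have "\<dots> < 1 / (1 - r\<^sup>2)" using lt r2 by (intro divide_strict_left_mono) auto
    finally show ?thesis .
  qed
  have d: "(f has_field_derivative of_real (\<rho>\<^sup>2) * deriv g w - 2 * cnj w * of_real \<rho> * g w) (at 0)"
  proof -
    have \<phi>0: "\<phi> 0 = w" by (simp add: \<phi>_def)
    have d\<phi>: "(\<phi> has_field_derivative of_real \<rho>) (at 0)"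
      unfolding \<phi>_def \<rho>_def by (auto intro!: derivative_eq_intros simp: complex_norm_square[symmetric] mult.commute
        simp flip: complex_norm_square)
    have dg: "(g has_field_derivative deriv g w) (at (\<phi> 0))"
      unfolding \<phi>0 using g w by (intro holomorphic_derivI[of _ unit_disk]) auto
    have dq: "((\<lambda>z. of_real \<rho> / (1 + cnj w * z)\<^sup>2) has_field_derivative - 2 * cnj w * of_real \<rho>) (at 0)"
      by (auto intro!: derivative_eq_intros)
    show ?thesis
      using DERIV_mult[OF DERIV_chain2[OF dg d\<phi>] dq] unfolding f_def
      by (simp add: \<phi>0 power2_eq_square algebra_simps)
  qed
  have f0: "cmod (f 0) = \<rho> * cmod (g w)" using \<rho> by (simp add: f_def \<phi>_def norm_mult)
  have "f holomorphic_on ball 0 r"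
    by (rule holomorphic_on_subset[OF fhol]) (use r in auto)
  from schwarz_pick_at_0[OF this r(1) M d] show ?thesis
    unfolding f0 by (simp add: mult.commute)
qed

text \<open>Here \<open>x = |m|^2\<close>, \<open>y = |n|\<close>, and the last hypothesis is
  Schwarz--Pick with radius 2/5. The radius is a compromise: a small one sharpens the bound at
  \<open>x = 1\<close>, a moderately larger one that at \<open>x = 0\<close>. It gives
  \<open>y^2\<close> at most about 8.86 at \<open>x = 0\<close> and 0.77 at \<open>x = 1\<close>, so
  with multiplier \<open>k\<close> the bound is about \<open>8.86 k\<close> and
  \<open>1 - 1.23 k\<close> there. Both are below 0.9 for \<open>k\<close> between 0.082 and 0.101;
  19/200 is such a value.\<close>

lemma variance_pointwise_bound:
  fixes x y :: real
  assumes "0 \<le> x" "x \<le> 1" "0 \<le> y"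
    and "2/5 * y \<le> 1 / (1 - (2/5)\<^sup>2) - (1 - (2/5)\<^sup>2) * x"
  shows "x + 19/200 * (y\<^sup>2 - 2 * x) \<le> 177/200"
proof -
  define c where "c = 625/210 - 21/10 * x"
  have y: "y \<le> c" using assms(4) by (simp add: c_def power2_eq_square field_simps)
  then have "y\<^sup>2 \<le> c\<^sup>2" using assms(3) by (rule power_mono)
  \<comment> \<open>\<open>c^2\<close> is convex in \<open>x\<close>, hence lies below its chord on
    [0,1]; what remains is linear in \<open>x\<close>.\<close>
  also have "c\<^sup>2 \<le> (625/210)\<^sup>2 + x * ((625/210 - 21/10)\<^sup>2 - (625/210)\<^sup>2)"
  proof -
    have "(625/210)\<^sup>2 + x * ((625/210 - 21/10)\<^sup>2 - (625/210)\<^sup>2) - c\<^sup>2 = (21/10)\<^sup>2 * (x * (1 - x))"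
      by (simp add: c_def power2_eq_square algebra_simps)
    then show ?thesis using assms(1,2) by (smt (verit) mult_nonneg_nonneg zero_le_power2)
  qed
  finally have "y\<^sup>2 \<le> 15625/1764 - 809/100 * x" by (simp add: power2_eq_square)
  then show ?thesis using assms(2) by (simp add: field_simps)
qed

text \<open>At \<open>|m| = 1\<close> the estimate gains if \<open>|n|^2 + |n|/2 < 1\<close>.
  Schwarz--Pick with radius 1/5 gives \<open>|n|\<close> at most 0.41 there, while radius 2/5 would
  only give 0.88, which is too much. The price is a bound of 5.2 for \<open>|n|\<close> where
  \<open>m\<close> is small; the factor 1/4000 makes the correction harmless there.\<close>

lemma correction_pointwise_bound:
  fixes m n w :: complex
  assumes m: "cmod m \<le> 1" and w: "cmod w \<le> 1"
    and n: "1/5 * cmod n \<le> 1 / (1 - (1/5)\<^sup>2) - (1 - (1/5)\<^sup>2) * (cmod m)\<^sup>2"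
  shows "cmod (m + of_real (1/4000) *
      (2 * m * (n * cnj n) - 2 * m * (m * cnj m) - cnj w * m\<^sup>2 * cnj n)) \<le> 1 - 1/10000"
proof -
  define s where "s = cmod m"
  define y where "y = cmod n"
  have s: "0 \<le> s" "s \<le> 1" and y0: "0 \<le> y" using m by (auto simp: s_def y_def)
  have y: "y \<le> 125/24 - 24/5 * s\<^sup>2"
    using n by (simp add: s_def y_def power2_eq_square field_simps)
  have eq: "m + of_real (1/4000) * (2 * m * (n * cnj n) - 2 * m * (m * cnj m) - cnj w * m\<^sup>2 * cnj n)
    = m * of_real (1 - s\<^sup>2/2000 + y\<^sup>2/2000) - of_real (1/4000) * (cnj w * m\<^sup>2 * cnj n)"
    unfolding s_def y_def of_real_add of_real_diff of_real_divide complex_norm_square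
    by (simp add: power2_eq_square algebra_simps)
  have pos: "0 \<le> 1 - s\<^sup>2/2000 + y\<^sup>2/2000"
    using s power_le_one[of s 2] zero_le_power2[of y] by linarith
  have "cmod (m * of_real (1 - s\<^sup>2/2000 + y\<^sup>2/2000) - of_real (1/4000) * (cnj w * m\<^sup>2 * cnj n))
    \<le> s * (1 - s\<^sup>2/2000 + y\<^sup>2/2000) + 1/4000 * (1 * s\<^sup>2 * y)"
  proof (rule order_trans[OF norm_triangle_ineq4 add_mono])
    show "cmod (m * of_real (1 - s\<^sup>2/2000 + y\<^sup>2/2000)) \<le> s * (1 - s\<^sup>2/2000 + y\<^sup>2/2000)"
      using pos by (simp only: norm_mult norm_of_real s_def)
    have "cmod w * (s\<^sup>2 * y) \<le> 1 * (s\<^sup>2 * y)" using w y0 by (intro mult_right_mono) auto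
    then show "cmod (of_real (1/4000) * (cnj w * m\<^sup>2 * cnj n)) \<le> 1/4000 * (1 * s\<^sup>2 * y)"
      by (simp add: norm_mult norm_power s_def y_def mult_ac)
  qed
  also have "\<dots> \<le> 1 - 1/10000"
  \<comment> \<open>Below 39/40 the slack \<open>1 - s\<close> absorbs the crude bound
    \<open>y \<le> 5.3\<close>. Above it \<open>y \<le> 0.646\<close>, and the gain
    \<open>s^2 - y^2\<close> outweighs the loss \<open>s^2 * y / 2\<close> by just enough to leave
    1/10000.\<close>
  proof (cases "s \<le> 39/40")
    case True
    have "y \<le> 53/10" using y zero_le_power2[of s] by linarith
    then have "y\<^sup>2 \<le> (53/10)\<^sup>2" using y0 by (intro power_mono)
    then have "y\<^sup>2 \<le> 2809/100" by (simp add: power2_eq_square)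
    then have "1 - s\<^sup>2/2000 + y\<^sup>2/2000 \<le> 1 + 2809/200000" using zero_le_power2[of s] by linarith
    then have 1: "s * (1 - s\<^sup>2/2000 + y\<^sup>2/2000) \<le> 39/40 * (1 + 2809/200000)"
      using True s pos by (intro mult_mono) auto
    have "s\<^sup>2 * y \<le> 1 * (53/10)" using s y0 \<open>y \<le> 53/10\<close> by (intro mult_mono power_le_one) auto
    then have 2: "1/4000 * (1 * s\<^sup>2 * y) \<le> 1/4000 * (53/10)" by (simp add: mult.commute)
    show ?thesis by (rule order_trans[OF add_mono[OF 1 2]]) simp
  next
    case False
    then have s2: "(39/40)\<^sup>2 \<le> s\<^sup>2" by (intro power_mono) auto
    then have yb: "y \<le> 646/1000" using y by (simp add: power2_eq_square)
    then have "y\<^sup>2 \<le> (646/1000)\<^sup>2" using y0 by (intro power_mono)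
    then have 1: "1 - s\<^sup>2/2000 + y\<^sup>2/2000 \<le> 1 - (9506/10000 - 4174/10000)/2000"
      using s2 by (simp add: power2_eq_square)
    have 3: "s * (1 - s\<^sup>2/2000 + y\<^sup>2/2000) \<le> 1 * (1 - (9506/10000 - 4174/10000)/2000)"
      by (intro mult_mono 1 s pos) simp
    have "s\<^sup>2 * y \<le> 1 * (646/1000)" using s y0 yb by (intro mult_mono power_le_one) auto
    then have 2: "1/4000 * (1 * s\<^sup>2 * y) \<le> 1/4000 * (646/1000)" by (simp add: mult.commute)
    show ?thesis by (rule order_trans[OF add_mono[OF 3 2]]) simp
  qed
  finally show ?thesis unfolding eq .
qed

subsection \<open>Circle means of power series\<close>

lemma integral_exp_circle:
  fixes k :: int
  shows "((\<lambda>t. exp (2 * of_real pi * \<i> * of_int k * of_real t)) has_integral (if k = 0 then 1 else 0)) {0..1}"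
proof (cases "k = 0")
  case False
  define c where "c = 2 * of_real pi * \<i> * of_int k"
  have c: "c \<noteq> 0" using False by (simp add: c_def)
  have "((\<lambda>t. exp (c * of_real t)) has_integral (exp (c * of_real 1) / c - exp (c * of_real 0) / c)) {0..1}"
  proof (rule fundamental_theorem_of_calculus)
    fix x :: real
    have "((\<lambda>z. exp (c * z) / c) has_field_derivative exp (c * of_real x)) (at (of_real x))"
      using c by (auto intro!: derivative_eq_intros)
    then show "((\<lambda>t. exp (c * of_real t) / c) has_vector_derivative exp (c * of_real x)) (at x within {0..1})"
      by (rule has_vector_derivative_real_field)
  qed simp
  moreover have "exp c = 1" unfolding c_def exp_eq_1 by (auto intro!: exI[of _ k])
  ultimately show ?thesis using False by (simp add: c_def)
qed (use has_integral_const_real[of "1::complex" 0 1] in simp)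

lemma norm_exp_2pi_i [simp]: "norm (exp (2 * of_real pi * \<i> * of_real t)) = 1"
  using norm_exp_i_times[of "2 * pi * t"] by (simp add: mult_ac)

lemma exp_2pi_i_power:
  "exp (2 * of_real pi * \<i> * of_nat n * of_real t) = exp (2 * of_real pi * \<i> * of_real t) ^ n"
proof -
  have "2 * of_real pi * \<i> * of_nat n * of_real t = of_nat n * (2 * of_real pi * \<i> * of_real t)"
    by simp
  then show ?thesis by (simp only: exp_of_nat_mult)
qed

lemma parseval_sum:
  fixes A :: "nat \<Rightarrow> complex"
  shows "((\<lambda>t. (norm (\<Sum>n<N. A n * exp (2 * of_real pi * \<i> * of_nat n * of_real t)))\<^sup>2) has_integral
      (\<Sum>n<N. (norm (A n))\<^sup>2)) {0..1}"
proof -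
  define e where "e = (\<lambda>n t. exp (2 * of_real pi * \<i> * of_nat n * of_real t) :: complex)"
  have ee: "e j t * cnj (e k t) = exp (2 * of_real pi * \<i> * of_int (int j - int k) * of_real t)" for j k t
    by (simp add: e_def exp_cnj algebra_simps flip: exp_add)
  have "((\<lambda>t. \<Sum>j<N. \<Sum>k<N. A j * cnj (A k) * (e j t * cnj (e k t))) has_integral
      (\<Sum>j<N. \<Sum>k<N. A j * cnj (A k) * (if int j - int k = 0 then 1 else 0))) {0..1}"
    unfolding ee by (intro has_integral_sum has_integral_mult_right integral_exp_circle) auto
  also have "(\<Sum>j<N. \<Sum>k<N. A j * cnj (A k) * (if int j - int k = 0 then 1 else 0)) = of_real (\<Sum>j<N. (norm (A j))\<^sup>2)"
    by (simp add: if_distrib sum.delta complex_norm_square del: of_real_power cong: if_cong)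
  also have "(\<lambda>t. \<Sum>j<N. \<Sum>k<N. A j * cnj (A k) * (e j t * cnj (e k t))) =
      (\<lambda>t. of_real ((norm (\<Sum>n<N. A n * e n t))\<^sup>2))"
    by (rule ext) (simp add: complex_norm_square sum_product mult_ac del: of_real_power)
  finally have "((\<lambda>t. complex_of_real ((norm (\<Sum>n<N. A n * e n t))\<^sup>2)) has_integral of_real (\<Sum>j<N. (norm (A j))\<^sup>2)) {0..1}" .
  from has_integral_linear[OF this bounded_linear_Re] show ?thesis
    by (simp add: o_def e_def)
qed

lemma summable_norm_sq:
  assumes "summable (\<lambda>n. norm (A n))"
  shows "summable (\<lambda>n. (norm (A n))\<^sup>2)"
proof (rule summable_comparison_test_ev[OF _ assms])
  have "\<forall>\<^sub>F n in sequentially. norm (A n) < 1"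
    using summable_LIMSEQ_zero[OF assms] by (rule order_tendstoD) simp
  then show "\<forall>\<^sub>F n in sequentially. norm ((norm (A n))\<^sup>2) \<le> norm (A n)"
    by eventually_elim (simp add: power2_eq_square mult_left_le)
qed

text \<open>Absolute summability, available at every radius below 1, bounds all partial sums by the
  sum of \<open>norm (A n)\<close>; dominated convergence then carries Parseval over from
  polynomials.\<close>

lemma parseval_series:
  fixes A :: "nat \<Rightarrow> complex"
  assumes A: "summable (\<lambda>n. norm (A n))"
  shows "((\<lambda>t. (norm (\<Sum>n. A n * exp (2 * of_real pi * \<i> * of_nat n * of_real t)))\<^sup>2) has_integral
      (\<Sum>n. (norm (A n))\<^sup>2)) {0..1}"
proof -
  define e where "e = (\<lambda>n t. exp (2 * of_real pi * \<i> * of_nat n * of_real t) :: complex)"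
  have ne: "norm (e n t) = 1" for n t
    unfolding e_def exp_2pi_i_power by (simp add: norm_power)
  have sA: "summable (\<lambda>n. A n * e n t)" for t
    by (rule summable_norm_cancel) (simp add: norm_mult ne A)
  have le: "norm (\<Sum>n<N. A n * e n t) \<le> (\<Sum>n. norm (A n))" for N t
    by (rule order_trans[OF norm_sum]) (simp add: norm_mult ne sum_le_suminf[OF A])
  have conv: "(\<lambda>N. (norm (\<Sum>n<N. A n * e n t))\<^sup>2) \<longlonglongrightarrow> (norm (\<Sum>n. A n * e n t))\<^sup>2" for t
    by (intro tendsto_intros summable_LIMSEQ sA)
  have P: "((\<lambda>t. (norm (\<Sum>n<N. A n * e n t))\<^sup>2) has_integral (\<Sum>n<N. (norm (A n))\<^sup>2)) {0..1}" for N
    unfolding e_def by (rule parseval_sum)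
  have int: "(\<lambda>t. (norm (\<Sum>n<N. A n * e n t))\<^sup>2) integrable_on {0..1}" for N
    using P by (rule has_integral_integrable)
  have le2: "norm ((norm (\<Sum>n<N. A n * e n t))\<^sup>2) \<le> (\<Sum>n. norm (A n))\<^sup>2" for N t
    using power_mono[OF le[where N = N and t = t], of 2] by simp
  have *: "(\<lambda>t. (norm (\<Sum>n. A n * e n t))\<^sup>2) integrable_on {0..1}"
    "(\<lambda>N. integral {0..1} (\<lambda>t. (norm (\<Sum>n<N. A n * e n t))\<^sup>2)) \<longlonglongrightarrow> integral {0..1} (\<lambda>t. (norm (\<Sum>n. A n * e n t))\<^sup>2)"
    by (rule dominated_convergence[OF int integrable_const_ivl le2 conv])+
  have "summable (\<lambda>n. (norm (A n))\<^sup>2)"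
    using summable_norm_sq[OF A] .
  then have "(\<lambda>N. \<Sum>n<N. (norm (A n))\<^sup>2) \<longlonglongrightarrow> (\<Sum>n. (norm (A n))\<^sup>2)"
    by (rule summable_LIMSEQ)
  moreover have "integral {0..1} (\<lambda>t. (norm (\<Sum>n<N. A n * e n t))\<^sup>2) = (\<Sum>n<N. (norm (A n))\<^sup>2)" for N
    using P by (simp add: has_integral_iff)
  ultimately have "(\<lambda>N. integral {0..1} (\<lambda>t. (norm (\<Sum>n<N. A n * e n t))\<^sup>2)) \<longlonglongrightarrow> (\<Sum>n. (norm (A n))\<^sup>2)"
    by simp
  then have "integral {0..1} (\<lambda>t. (norm (\<Sum>n. A n * e n t))\<^sup>2) = (\<Sum>n. (norm (A n))\<^sup>2)"
    by (rule LIMSEQ_unique[OF *(2)])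
  then show ?thesis
    using *(1) unfolding e_def has_integral_iff by blast
qed

text \<open>The mean of \<open>|f|^2\<close> over the circle \<open>|z|^2 = t\<close>, for
  \<open>f\<close> with Taylor coefficients \<open>a\<close>. With \<open>t = |z|^2\<close> as
  variable it is a power series that can be differentiated in \<open>t\<close>.\<close>

definition coeff_mean :: "(nat \<Rightarrow> complex) \<Rightarrow> real \<Rightarrow> real" where
  "coeff_mean a t = (\<Sum>n. (norm (a n))\<^sup>2 * t ^ n)"

lemma disk_series_abs_summable:
  fixes a :: "nat \<Rightarrow> complex"
  assumes a: "\<And>z. z \<in> unit_disk \<Longrightarrow> summable (\<lambda>n. a n * z ^ n)" and r: "0 \<le> r" "r < 1"
  shows "summable (\<lambda>n. norm (a n) * r ^ n)"
proof -
  define R where "R = (1 + r) / 2"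
  have "summable (\<lambda>n. a n * of_real R ^ n)" using r by (intro a) (auto simp: R_def simp del: of_real_divide of_real_add)
  from powser_insidea[OF this, of "of_real r"] r show ?thesis
    by (simp add: R_def norm_mult norm_power del: of_real_divide of_real_add)
qed

lemma coeff_mean_summable:
  fixes a :: "nat \<Rightarrow> complex"
  assumes a: "\<And>z. z \<in> unit_disk \<Longrightarrow> summable (\<lambda>n. a n * z ^ n)" and t: "0 \<le> t" "t < 1"
  shows "summable (\<lambda>n. (norm (a n))\<^sup>2 * t ^ n)"
proof -
  have s: "summable (\<lambda>n. norm (a n) * sqrt t ^ n)"
    by (rule disk_series_abs_summable[OF a]) (use t in auto)
  have eq: "(norm (a n) * sqrt t ^ n)\<^sup>2 = (norm (a n))\<^sup>2 * t ^ n" for n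
    using t by (simp add: power_mult_distrib power_mult[symmetric] power2_eq_square flip: power_mult_distrib)
  show ?thesis
    using summable_norm_sq[of "\<lambda>n. norm (a n) * sqrt t ^ n"] s t unfolding eq[symmetric] by simp
qed

lemma circle_mean_eq_coeff_mean:
  fixes a :: "nat \<Rightarrow> complex"
  assumes a: "\<And>z. z \<in> unit_disk \<Longrightarrow> (\<lambda>n. a n * z ^ n) sums f z" and r: "0 \<le> r" "r < 1"
  shows "((\<lambda>t. (norm (f (of_real r * exp (2 * of_real pi * \<i> * of_real t))))\<^sup>2) has_integral coeff_mean a (r\<^sup>2)) {0..1}"
proof -
  define A where "A = (\<lambda>n. a n * of_real r ^ n)"
  have A: "summable (\<lambda>n. norm (A n))"
    using disk_series_abs_summable[OF sums_summable[OF a] r] r by (simp add: A_def norm_mult norm_power)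
  have "(\<Sum>n. A n * exp (2 * of_real pi * \<i> * of_nat n * of_real t)) = f (of_real r * exp (2 * of_real pi * \<i> * of_real t))" for t
  proof -
    have "of_real r * exp (2 * of_real pi * \<i> * of_real t) \<in> unit_disk"
      using r by (simp add: norm_mult)
    from sums_unique[OF a[OF this]] show ?thesis
      unfolding exp_2pi_i_power A_def unfolding power_mult_distrib mult.assoc by simp
  qed
  moreover have "(norm (A n))\<^sup>2 = (norm (a n))\<^sup>2 * (r\<^sup>2) ^ n" for n
    using r by (simp add: A_def norm_mult norm_power power_mult_distrib power_mult[symmetric] mult.commute)
  ultimately show ?thesis
    using parseval_series[OF A] by (simp add: coeff_mean_def)
qed

text \<open>The arc length factor \<open>2 * pi * r\<close> cancels \<open>2 * pi\<close> and leaves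
  \<open>r\<close>; radius \<open>r\<close> corresponds to \<open>t = r^2\<close>.\<close>

lemma asymptotic_variance_eq:
  fixes a :: "nat \<Rightarrow> complex"
  assumes a: "\<And>z. z \<in> unit_disk \<Longrightarrow> (\<lambda>n. a n * z ^ n) sums f z"
  shows "asymptotic_variance f = Limsup (at_left 1) (\<lambda>r. ereal (r * coeff_mean a (r\<^sup>2) / - ln (1 - r)))"
  unfolding asymptotic_variance_def
proof (rule Limsup_eq)
  show "\<forall>\<^sub>F r in at_left 1. ereal (1 / (2 * pi * \<bar>ln (1 - r)\<bar>) *
      arc_length_integral (circlepath 0 r) (\<lambda>z. (norm (f z))\<^sup>2)) = ereal (r * coeff_mean a (r\<^sup>2) / - ln (1 - r))"
  proof (rule eventually_at_leftI[of 0])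
    fix r :: real assume "r \<in> {0<..<1}"
    then have r: "0 \<le> r" "r < 1" "r \<noteq> 0" by auto
    have l: "ln (1 - r) < 0" using r by simp
    have "norm (vector_derivative (circlepath 0 r) (at t)) = 2 * pi * r" for t
      using r by (simp add: vector_derivative_circlepath norm_mult)
    then have "arc_length_integral (circlepath 0 r) (\<lambda>z. (norm (f z))\<^sup>2) = coeff_mean a (r\<^sup>2) * (2 * pi * r)"
      unfolding arc_length_integral_def
      using has_integral_mult_left[OF circle_mean_eq_coeff_mean[OF a r(1,2)], of "2 * pi * r"]
      by (simp add: circlepath has_integral_iff)
    moreover have "1 / (2 * pi * L) * (c * (2 * pi * r)) = r * c / L" if "L \<noteq> 0" for c L
      using that by (simp add: field_simps)
    ultimately show "ereal (1 / (2 * pi * \<bar>ln (1 - r)\<bar>) *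
      arc_length_integral (circlepath 0 r) (\<lambda>z. (norm (f z))\<^sup>2)) = ereal (r * coeff_mean a (r\<^sup>2) / - ln (1 - r))"
      using l by (simp only: abs_of_neg)
  qed simp
qed

subsection \<open>Growth of the circle means of a Bloch function\<close>

text \<open>The Euler operator \<open>t d/dt\<close> multiplies the \<open>n\<close>-th coefficient
  by \<open>n\<close> without shifting indices, so series built with it can be combined term by
  term.\<close>

lemma real_series_theta_deriv:
  fixes q :: "nat \<Rightarrow> real"
  assumes q: "\<And>t. \<bar>t\<bar> < 1 \<Longrightarrow> summable (\<lambda>n. q n * t ^ n)" and t: "\<bar>t\<bar> < 1"
  shows "((\<lambda>t. \<Sum>n. q n * t ^ n) has_field_derivative (\<Sum>n. diffs q n * t ^ n)) (at t)"
    and "(\<lambda>n. of_nat n * q n * t ^ n) sums (t * (\<Sum>n. diffs q n * t ^ n))"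
proof -
  show "((\<lambda>t. \<Sum>n. q n * t ^ n) has_field_derivative (\<Sum>n. diffs q n * t ^ n)) (at t)"
    by (rule termdiffs_strong'[of 1]) (use q t in auto)
  have "summable (\<lambda>n. diffs q n * t ^ n)"
    by (rule termdiff_converges[of _ 1]) (use q t in auto)
  from sums_mult[OF diffs_equiv[OF this], of t]
  have "(\<lambda>n. t * (of_nat n * q n * t ^ (n - Suc 0))) sums (t * (\<Sum>n. diffs q n * t ^ n))" .
  moreover have "t * (of_nat n * q n * t ^ (n - Suc 0)) = of_nat n * q n * t ^ n" for n
    by (cases n) auto
  ultimately show "(\<lambda>n. of_nat n * q n * t ^ n) sums (t * (\<Sum>n. diffs q n * t ^ n))"
    by simp
qed

lemma disk_series_deriv:
  fixes a :: "nat \<Rightarrow> complex"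
  assumes a: "\<And>z. z \<in> unit_disk \<Longrightarrow> (\<lambda>n. a n * z ^ n) sums f z" and z: "z \<in> unit_disk"
  shows "(\<lambda>n. diffs a n * z ^ n) sums deriv f z"
    and "(\<lambda>n. of_nat n * a n * z ^ n) sums (z * deriv f z)"
proof -
  have s: "summable (\<lambda>n. a n * z ^ n)" if "norm z < 1" for z
    using sums_summable[OF a] that by simp
  have sd: "summable (\<lambda>n. diffs a n * z ^ n)"
    by (rule termdiff_converges[of _ 1]) (use s z in auto)
  have "((\<lambda>z. \<Sum>n. a n * z ^ n) has_field_derivative (\<Sum>n. diffs a n * z ^ n)) (at z)"
    by (rule termdiffs_strong'[of 1]) (use s z in auto)
  then have "(f has_field_derivative (\<Sum>n. diffs a n * z ^ n)) (at z)"
    by (rule has_field_derivative_transform_within_open[of _ _ _ unit_disk])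
      (use z a in \<open>auto simp: sums_iff\<close>)
  then have d: "deriv f z = (\<Sum>n. diffs a n * z ^ n)" by (rule DERIV_imp_deriv)
  then show "(\<lambda>n. diffs a n * z ^ n) sums deriv f z"
    using sd by (simp add: summable_sums)
  from sums_mult[OF diffs_equiv[OF sd], of z]
  have "(\<lambda>n. z * (of_nat n * a n * z ^ (n - Suc 0))) sums (z * deriv f z)" unfolding d .
  moreover have "z * (of_nat n * a n * z ^ (n - Suc 0)) = of_nat n * a n * z ^ n" for n
    by (cases n) auto
  ultimately show "(\<lambda>n. of_nat n * a n * z ^ n) sums (z * deriv f z)" by simp
qed

text \<open>To be read with \<open>g = b'\<close>. On \<open>|z|^2 = t\<close> the weight
  \<open>1 - t\<close> is constant, so for frozen \<open>t\<close> the product \<open>z * n\<close>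
  agrees there with a holomorphic function \<open>h\<close>, and Parseval computes the mean of
  \<open>t * |n|^2 = |h|^2\<close>. The coefficient 81/100 is \<open>1 - 2 * 19/200\<close>.\<close>

lemma bloch_circle_mean_inequality:
  fixes a :: "nat \<Rightarrow> complex"
  assumes g: "\<And>z. z \<in> unit_disk \<Longrightarrow> (\<lambda>n. a n * z ^ n) sums g z" and hol: "g holomorphic_on unit_disk"
    and bd: "\<And>z. z \<in> unit_disk \<Longrightarrow> (1 - (cmod z)\<^sup>2) * cmod (g z) \<le> 1"
    and t: "0 < t" "t < 1"
  shows "81/100 * (t * (1 - t)\<^sup>2 * coeff_mean a t) +
     19/200 * coeff_mean (\<lambda>n. of_real ((1 - t)\<^sup>2 * real n - 2 * t * (1 - t)) * a n) t \<le> 177/200 * t"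
proof -
  define r where "r = sqrt t"
  have r: "0 \<le> r" "r < 1" "r\<^sup>2 = t" using t by (auto simp: r_def)
  define h where "h = (\<lambda>z. of_real ((1 - t)\<^sup>2) * (z * deriv g z) - of_real (2 * t * (1 - t)) * g z)"
  have h: "(\<lambda>n. of_real ((1 - t)\<^sup>2 * real n - 2 * t * (1 - t)) * a n * z ^ n) sums h z" if "z \<in> unit_disk" for z
  proof -
    have "(\<lambda>n. of_real ((1 - t)\<^sup>2) * (of_nat n * a n * z ^ n) - of_real (2 * t * (1 - t)) * (a n * z ^ n)) sums h z"
      unfolding h_def by (intro sums_diff sums_mult disk_series_deriv(2)[OF g] g that)
    then show ?thesis by (simp add: algebra_simps)
  qed
  define z where "z = (\<lambda>u. of_real r * exp (2 * of_real pi * \<i> * of_real u) :: complex)"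
  have pw: "81/100 * (t * (1 - t)\<^sup>2 * (cmod (g (z u)))\<^sup>2) + 19/200 * (cmod (h (z u)))\<^sup>2 \<le> 177/200 * t" for u
  proof -
    have nz: "cmod (z u) = r" using r by (simp add: z_def norm_mult)
    then have zD: "z u \<in> unit_disk" using r by simp
    define x where "x = (1 - t)\<^sup>2 * (cmod (g (z u)))\<^sup>2"
    define y where "y = cmod (of_real ((1 - t)\<^sup>2) * deriv g (z u) - 2 * cnj (z u) * of_real (1 - t) * g (z u))"
    have x1: "x \<le> 1"
      using bd[OF zD] r t unfolding nz x_def power_mult_distrib[symmetric]
      by (intro power_le_one) auto
    have "2/5 * y \<le> 1 / (1 - (2/5)\<^sup>2) - (1 - (2/5)\<^sup>2) * x"
      using bloch_second_derivative_bound[OF hol bd zD, of "2/5"]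
      unfolding nz r(3) y_def x_def by (simp add: power_mult_distrib)
    then have main: "x + 19/200 * (y\<^sup>2 - 2 * x) \<le> 177/200"
      by (intro variance_pointwise_bound x1) (auto simp: x_def y_def)
    have assoc: "v * (p * d - 2 * v' * s * G) = p * (v * d) - 2 * (v * v') * s * G"
      for v p d v' s G :: complex
      by (simp add: algebra_simps)
    have "z u * cnj (z u) = of_real t"
      using nz r by (simp add: complex_norm_square[symmetric] flip: of_real_power)
    then have "h (z u) = z u * (of_real ((1 - t)\<^sup>2) * deriv g (z u) - 2 * cnj (z u) * of_real (1 - t) * g (z u))"
      using assoc[of "z u" "of_real ((1 - t)\<^sup>2)" "deriv g (z u)" "cnj (z u)" "of_real (1 - t)" "g (z u)"]
      by (simp add: h_def)
    then have "(cmod (h (z u)))\<^sup>2 = t * y\<^sup>2"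
      using nz r by (simp add: norm_mult power_mult_distrib y_def)
    then have "81/100 * (t * (1 - t)\<^sup>2 * (cmod (g (z u)))\<^sup>2) + 19/200 * (cmod (h (z u)))\<^sup>2
      = t * (x + 19/200 * (y\<^sup>2 - 2 * x))" by (simp add: x_def algebra_simps)
    also have "\<dots> \<le> t * (177/200)" using main t by (intro mult_left_mono) auto
    finally show ?thesis by simp
  qed
  have "((\<lambda>u. 81/100 * (t * (1 - t)\<^sup>2 * (cmod (g (z u)))\<^sup>2) + 19/200 * (cmod (h (z u)))\<^sup>2) has_integral
     (81/100 * (t * (1 - t)\<^sup>2 * coeff_mean a (r\<^sup>2)) +
     19/200 * coeff_mean (\<lambda>n. of_real ((1 - t)\<^sup>2 * real n - 2 * t * (1 - t)) * a n) (r\<^sup>2))) {0..1}"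
    unfolding z_def
    by (intro has_integral_add has_integral_mult_right circle_mean_eq_coeff_mean[OF g r(1,2)] circle_mean_eq_coeff_mean[OF h r(1,2)])
  moreover have "((\<lambda>u::real. 177/200 * t) has_integral (177/200 * t)) {0..1}"
    using has_integral_const_real[of "177/200 * t" 0 1] by simp
  ultimately show ?thesis
    unfolding r(3) by (rule has_integral_le) (use pw in auto)
qed

text \<open>Write \<open>X(t) = (1 - t)\<^sup>2 A\<^sub>0(t)\<close> for the mean of \<open>|m|\<^sup>2\<close> over \<open>|z|\<^sup>2 = t\<close>. The mean of \<open>|n|\<^sup>2 - 2 |m|\<^sup>2\<close>
  is \<open>(1 - t)\<^sup>2 (t X')'\<close>, and \<open>A\<^sub>0 = (t M')'\<close> for the mean \<open>M\<close> of \<open>|b|\<^sup>2\<close>, so the pointwise inequality can be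
  integrated twice.\<close>

lemma bloch_coeff_mean_bound:
  fixes a :: "nat \<Rightarrow> complex"
  assumes b: "\<And>z. z \<in> unit_disk \<Longrightarrow> (\<lambda>n. a n * z ^ n) sums b z" and hol: "b holomorphic_on unit_disk"
    and bd: "\<And>z. z \<in> unit_disk \<Longrightarrow> (1 - (cmod z)\<^sup>2) * cmod (deriv b z) \<le> 1"
    and t: "0 \<le> t" "t < 1"
  shows "coeff_mean a t \<le> 177/200 * - ln (1 - t) + (cmod (a 0))\<^sup>2 + 19/200 * (cmod (a 1))\<^sup>2"
proof -
  define c where "c = (\<lambda>n. (cmod (a n))\<^sup>2)"
  define q where "q = (\<lambda>n. (cmod (diffs a n))\<^sup>2)"
  note g = disk_series_deriv(1)[OF b]
  have ghol: "deriv b holomorphic_on unit_disk" using hol by (rule holomorphic_deriv) simp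
  have sq: "summable (\<lambda>n. q n * t ^ n)" if "\<bar>t\<bar> < 1" for t
    by (rule summable_norm_cancel)
      (use coeff_mean_summable[OF sums_summable[OF g], of "\<bar>t\<bar>"] that in \<open>simp add: q_def abs_mult power_abs\<close>)
  have sc: "summable (\<lambda>n. c n * t ^ n)" if "\<bar>t\<bar> < 1" for t
    by (rule summable_norm_cancel)
      (use coeff_mean_summable[OF sums_summable[OF b], of "\<bar>t\<bar>"] that in \<open>simp add: c_def abs_mult power_abs\<close>)
  define nc where "nc = (\<lambda>n. real n * c n)"
  define nq where "nq = (\<lambda>n. real n * q n)"
  have snc: "summable (\<lambda>n. nc n * t ^ n)" if "\<bar>t\<bar> < 1" for t
    using real_series_theta_deriv(2)[OF sc that] by (simp add: nc_def sums_iff)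
  have snq: "summable (\<lambda>n. nq n * t ^ n)" if "\<bar>t\<bar> < 1" for t
    using real_series_theta_deriv(2)[OF sq that] by (simp add: nq_def sums_iff)
  define M where "M = (\<lambda>t. \<Sum>n. c n * t ^ n)"
  define S where "S = (\<lambda>t. \<Sum>n. nc n * t ^ n)"
  define A0 where "A0 = (\<lambda>t. \<Sum>n. q n * t ^ n)"
  define A1 where "A1 = (\<lambda>t. \<Sum>n. nq n * t ^ n)"
  define A2 where "A2 = (\<lambda>t. \<Sum>n. real n * nq n * t ^ n)"
  have dM: "(M has_field_derivative S t / t) (at t)" if "0 < t" "t < 1" for t
    using real_series_theta_deriv[OF sc, of t] that unfolding M_def S_def nc_def by (simp add: sums_iff)
  have dA0: "(A0 has_field_derivative A1 t / t) (at t)" if "0 < t" "t < 1" for t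
    using real_series_theta_deriv[OF sq, of t] that unfolding A0_def A1_def nq_def by (simp add: sums_iff)
  have dA1: "(A1 has_field_derivative A2 t / t) (at t)" if "0 < t" "t < 1" for t
    using real_series_theta_deriv[OF snq, of t] that unfolding A1_def A2_def by (simp add: sums_iff)
  \<comment> \<open>This is \<open>(t M')' = A0\<close> on coefficients: differentiating the series
    of \<open>n |a n|^2\<close> produces \<open>(n+1)^2 |a (n+1)|^2\<close>.\<close>
  have "diffs nc = q"
    by (rule ext) (simp add: diffs_def nc_def q_def c_def norm_mult power_mult_distrib power2_eq_square
        norm_of_nat del: of_nat_Suc)
  then have dS: "(S has_field_derivative A0 t) (at t)" if "\<bar>t\<bar> < 1" for t
    using real_series_theta_deriv(1)[OF snc that] unfolding S_def A0_def by simp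
  \<comment> \<open>\<open>Y = t X'\<close> and \<open>Z = t Y'\<close>, so that
    \<open>Z t / t\<close> is \<open>(t X')'\<close>.\<close>
  define X where "X = (\<lambda>t. (1 - t)\<^sup>2 * A0 t)"
  define Y where "Y = (\<lambda>t. (1 - t)\<^sup>2 * A1 t - 2 * t * (1 - t) * A0 t)"
  define Z where "Z = (\<lambda>t. (1 - t)\<^sup>2 * A2 t - 4 * t * (1 - t) * A1 t + (4 * t\<^sup>2 - 2 * t) * A0 t)"
  have dX: "(X has_field_derivative Y t / t) (at t)" if "0 < t" "t < 1" for t
    unfolding X_def using that
    by (auto intro!: derivative_eq_intros dA0[OF that] simp: Y_def field_simps power2_eq_square)
  have dY: "(Y has_field_derivative Z t / t) (at t)" if "0 < t" "t < 1" for t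
    unfolding Y_def using that
    by (auto intro!: derivative_eq_intros dA0[OF that] dA1[OF that] simp: Z_def field_simps power2_eq_square)
  have main: "A0 t + 19/200 * (Z t / t) \<le> 177/200 / (1 - t)\<^sup>2" if t: "0 < t" "t < 1" for t
  proof -
    have "(\<lambda>n. (1 - t)^4 * (real n * nq n * t ^ n) - 4 * t * (1 - t)^3 * (nq n * t ^ n) + 4 * t\<^sup>2 * (1 - t)\<^sup>2 * (q n * t ^ n)) sums
      ((1 - t)^4 * A2 t - 4 * t * (1 - t)^3 * A1 t + 4 * t\<^sup>2 * (1 - t)\<^sup>2 * A0 t)"
      unfolding A2_def A1_def A0_def
      using t snq sq real_series_theta_deriv(2)[OF snq, of t]
      by (intro sums_add sums_diff sums_mult summable_sums) (auto simp: sums_iff)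
    also have "(\<lambda>n. (1 - t)^4 * (real n * nq n * t ^ n) - 4 * t * (1 - t)^3 * (nq n * t ^ n) + 4 * t\<^sup>2 * (1 - t)\<^sup>2 * (q n * t ^ n))
      = (\<lambda>n. (norm (of_real ((1 - t)\<^sup>2 * real n - 2 * t * (1 - t)) * diffs a n))\<^sup>2 * t ^ n)"
      unfolding nq_def q_def norm_mult norm_of_real power_mult_distrib power2_abs
      by (rule ext, simp only: power2_eq_square power3_eq_cube power4_eq_xxxx) (simp add: algebra_simps)
    finally have "coeff_mean (\<lambda>n. of_real ((1 - t)\<^sup>2 * real n - 2 * t * (1 - t)) * diffs a n) t
       = (1 - t)^4 * A2 t - 4 * t * (1 - t)^3 * A1 t + 4 * t\<^sup>2 * (1 - t)\<^sup>2 * A0 t"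
      by (simp add: coeff_mean_def sums_iff)
    moreover have "coeff_mean (diffs a) t = A0 t" by (simp add: coeff_mean_def A0_def q_def)
    ultimately have "81/100 * (t * (1 - t)\<^sup>2 * A0 t) +
       19/200 * ((1 - t)^4 * A2 t - 4 * t * (1 - t)^3 * A1 t + 4 * t\<^sup>2 * (1 - t)\<^sup>2 * A0 t) \<le> 177/200 * t"
      using bloch_circle_mean_inequality[OF g ghol bd t] by simp
    \<comment> \<open>In the factor \<open>4 t^2 - 2 t\<close> of \<open>A0\<close> in
      \<open>Z\<close>, the part \<open>4 t^2\<close> comes from the mean of \<open>|n|^2\<close>,
      and \<open>- 2 t\<close>, weighted by 19/200, makes up the difference between 81/100 and
      1.\<close>
    also have "81/100 * (t * (1 - t)\<^sup>2 * A0 t) +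
       19/200 * ((1 - t)^4 * A2 t - 4 * t * (1 - t)^3 * A1 t + 4 * t\<^sup>2 * (1 - t)\<^sup>2 * A0 t)
       = (A0 t + 19/200 * (Z t / t)) * (t * (1 - t)\<^sup>2)"
    proof -
      have "(A0 t + 19/200 * (Z t / t)) * (t * (1 - t)\<^sup>2) = (A0 t * t + 19/200 * Z t) * (1 - t)\<^sup>2"
        using t by (simp add: field_simps)
      moreover have "81/100 * (t * (1 - t)\<^sup>2 * A0 t) +
          19/200 * ((1 - t)^4 * A2 t - 4 * t * (1 - t)^3 * A1 t + 4 * t\<^sup>2 * (1 - t)\<^sup>2 * A0 t)
        = (A0 t * t + 19/200 * Z t) * (1 - t)\<^sup>2"
        unfolding Z_def power2_eq_square power3_eq_cube power4_eq_xxxx by (simp add: field_simps)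
      ultimately show ?thesis by (simp only:)
    qed
    finally have "A0 t + 19/200 * (Z t / t) \<le> 177/200 * t / (t * (1 - t)\<^sup>2)"
      using t by (subst pos_le_divide_eq) auto
    then show ?thesis using t by simp
  qed
  have cont: "continuous_on {0..s} A0" "continuous_on {0..s} A1" "continuous_on {0..s} M" "continuous_on {0..s} S"
    if "s < 1" for s
    unfolding A0_def A1_def M_def S_def
    by (rule DERIV_continuous_on, rule has_field_derivative_at_within, rule real_series_theta_deriv(1),
        (rule sq snq sc snc; assumption), use that in force)+
  \<comment> \<open>First integration: \<open>t / (1 - t)\<close> is the antiderivative of
    \<open>1 / (1 - t)^2\<close> that vanishes at 0, and \<open>main\<close> says that
    \<open>V\<close> increases.\<close>
  define V where "V = (\<lambda>t. 177/200 * (t / (1 - t)) - S t - 19/200 * Y t)"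
  have V: "V t \<ge> 0" if t: "0 \<le> t" "t < 1" for t
  proof -
    have "V 0 \<le> V t"
    proof (rule DERIV_nonneg_imp_increasing_open[OF t(1)])
      show "continuous_on {0..t} V" unfolding V_def Y_def
        using t by (intro continuous_intros cont) auto
      fix x assume x: "0 < x" "x < t"
      then have x1: "x < 1" using t by simp
      have "((\<lambda>t. t / (1 - t)) has_field_derivative 1 / (1 - x)\<^sup>2) (at x)"
        using x1 by (auto intro!: derivative_eq_intros simp: power2_eq_square)
      from DERIV_cmult[OF this, of "177/200"] dS[of x] DERIV_cmult[OF dY[OF x(1) x1], of "19/200"]
      have "(V has_field_derivative (177/200 / (1 - x)\<^sup>2 - A0 x - 19/200 * (Z x / x))) (at x)"
        unfolding V_def using x x1 by (intro DERIV_diff) auto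
      moreover have "177/200 / (1 - x)\<^sup>2 - A0 x - 19/200 * (Z x / x) \<ge> 0" using main[OF x(1) x1] by simp
      ultimately show "\<exists>y. (V has_real_derivative y) (at x) \<and> 0 \<le> y" by blast
    qed
    moreover have "V 0 = 0"
      by (simp add: V_def Y_def S_def A1_def nc_def nq_def powser_zero)
    ultimately show ?thesis by simp
  qed
  \<comment> \<open>Second integration: \<open>H' = V / t\<close>. The value \<open>H 0\<close>
    yields the terms in \<open>a 0\<close> and \<open>a 1\<close>; at \<open>t\<close> the boundary
    term \<open>X t\<close> is nonnegative, hence has the right sign to be dropped.\<close>
  define H where "H = (\<lambda>t. 177/200 * - ln (1 - t) - M t - 19/200 * X t)"
  have "H 0 \<le> H t"
  proof (rule DERIV_nonneg_imp_increasing_open[OF t(1)])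
    show "continuous_on {0..t} H" unfolding H_def X_def
      using t by (intro continuous_intros cont) auto
    fix x assume x: "0 < x" "x < t"
    then have x1: "x < 1" using t by simp
    have "(H has_field_derivative V x / x) (at x)"
      unfolding H_def V_def using x x1
      by (auto intro!: derivative_eq_intros dM dX simp: field_simps)
    moreover have "V x / x \<ge> 0" using V[of x] x x1 by simp
    ultimately show "\<exists>y. (H has_real_derivative y) (at x) \<and> 0 \<le> y" by blast
  qed
  moreover have "M 0 = (cmod (a 0))\<^sup>2" "X 0 = (cmod (a 1))\<^sup>2"
    by (simp_all add: M_def X_def A0_def c_def q_def powser_zero diffs_def)
  moreover have "X t \<ge> 0"
    unfolding X_def A0_def q_def using t by (intro mult_nonneg_nonneg suminf_nonneg sq[unfolded q_def]) auto
  moreover have "coeff_mean a t = M t" by (simp add: coeff_mean_def M_def c_def)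
  ultimately show ?thesis unfolding H_def by simp
qed

subsection \<open>Moments and the Bergman projection\<close>

text \<open>The kernel is the sum of \<open>(n+1) z^n cnj w^n\<close>, dominated uniformly in
  \<open>w\<close> for fixed \<open>z\<close>, and may be integrated termwise. So the projection
  sees \<open>\<mu>\<close> only through its moments against \<open>cnj w ^ n\<close>.\<close>

lemma bergman_projection_sums:
  assumes \<mu>: "\<mu> \<in> borel_measurable (lebesgue_on unit_disk)" and K: "\<And>w. w \<in> unit_disk \<Longrightarrow> norm (\<mu> w) \<le> K"
    and z: "z \<in> unit_disk"
  shows "(\<lambda>n. of_nat (Suc n) * ((\<integral>w. \<mu> w * cnj w ^ n \<partial>lebesgue_on unit_disk) / of_real pi) * z ^ n) sums
    bergman_projection \<mu> z"
proof -
  interpret finite_measure "lebesgue_on unit_disk"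
    by (rule finite_measure_lebesgue_on) auto
  have K0: "K \<ge> 0" using K[of 0] norm_ge_zero order_trans by (metis centre_in_ball zero_less_one)
  have cn: "norm (cnj w ^ n) \<le> 1" if "w \<in> unit_disk" for w n
    using that by (simp add: norm_power power_le_one)
  define f where "f = (\<lambda>n w. of_nat (Suc n) * z ^ n * (\<mu> w * cnj w ^ n))"
  have cmeas: "(\<lambda>w. cnj w ^ n) \<in> borel_measurable (lebesgue_on unit_disk)" for n
    by (intro continuous_imp_measurable_on_sets_lebesgue continuous_intros) auto
  have int0: "integrable (lebesgue_on unit_disk) (\<lambda>w. \<mu> w * cnj w ^ n)" for n
    by (rule integrable_disk_bounded[of _ K])
      (use \<mu> cmeas mult_mono[OF K cn] K0 in \<open>auto simp: norm_mult intro!: borel_measurable_times\<close>)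
  have intf: "integrable (lebesgue_on unit_disk) (f n)" for n
    unfolding f_def by (intro integrable_mult_right int0)
  have nf: "norm (f n w) \<le> of_nat (Suc n) * norm z ^ n * K" if "w \<in> unit_disk" for n w
    using mult_mono[OF K[OF that] cn[OF that, of n]] K0
    by (simp add: f_def norm_mult norm_power norm_of_nat del: of_nat_Suc) (intro mult_left_mono; simp)
  have sz: "summable (\<lambda>n. of_nat (Suc n) * norm z ^ n)"
    using geometric_deriv_sums[of "norm z"] z by (auto simp: sums_iff)
  have "(\<lambda>n. integral\<^sup>L (lebesgue_on unit_disk) (f n)) sums (\<integral>w. (\<Sum>n. f n w) \<partial>lebesgue_on unit_disk)"
  proof (rule sums_integral[OF intf])
    have "summable (\<lambda>n. norm (f n w))" if "w \<in> unit_disk" for w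
      by (rule summable_comparison_test'[OF summable_mult2[OF sz, of K]]) (use nf[OF that] in simp)
    then show "AE w in lebesgue_on unit_disk. summable (\<lambda>n. norm (f n w))"
      by (intro AE_I2) (simp add: space_restrict_space)
    have "(\<integral>w. norm (f n w) \<partial>lebesgue_on unit_disk) \<le> of_nat (Suc n) * norm z ^ n * K * measure (lebesgue_on unit_disk) (space (lebesgue_on unit_disk))" for n
    proof -
      have "(\<integral>w. norm (f n w) \<partial>lebesgue_on unit_disk) \<le> (\<integral>w. of_nat (Suc n) * norm z ^ n * K \<partial>lebesgue_on unit_disk)"
        by (rule integral_mono) (use nf intf in \<open>auto simp: space_restrict_space\<close>)
      then show ?thesis by (simp add: mult_ac)
    qed
    then show "summable (\<lambda>n. \<integral>w. norm (f n w) \<partial>lebesgue_on unit_disk)"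
      by (intro summable_comparison_test'[OF summable_mult2[OF summable_mult2[OF sz, of K], of "measure (lebesgue_on unit_disk) (space (lebesgue_on unit_disk))"]])
        simp
  qed
  also have "(\<integral>w. (\<Sum>n. f n w) \<partial>lebesgue_on unit_disk) = (\<integral>w. \<mu> w / (1 - z * cnj w)\<^sup>2 \<partial>lebesgue_on unit_disk)"
  proof (rule Bochner_Integration.integral_cong[OF refl])
    fix w assume "w \<in> space (lebesgue_on unit_disk)"
    then have w: "norm w < 1" by (simp add: space_restrict_space)
    have "norm (z * cnj w) < 1"
      using mult_strict_mono'[of "norm z" 1 "norm w" 1] w z by (simp add: norm_mult)
    from sums_mult[OF geometric_deriv_sums[OF this], of "\<mu> w"]
    have "(\<lambda>n. f n w) sums (\<mu> w / (1 - z * cnj w)\<^sup>2)"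
      by (simp add: f_def power_mult_distrib mult_ac)
    then show "(\<Sum>n. f n w) = \<mu> w / (1 - z * cnj w)\<^sup>2" by (rule sums_unique[symmetric])
  qed
  finally have "(\<lambda>n. integral\<^sup>L (lebesgue_on unit_disk) (f n)) sums (\<integral>w. \<mu> w / (1 - z * cnj w)\<^sup>2 \<partial>lebesgue_on unit_disk)" .
  from sums_mult[OF this, of "1 / of_real pi"]
  have "(\<lambda>n. 1 / of_real pi * integral\<^sup>L (lebesgue_on unit_disk) (f n)) sums bergman_projection \<mu> z"
    unfolding bergman_projection_def .
  moreover have "integral\<^sup>L (lebesgue_on unit_disk) (f n) = of_nat (Suc n) * z ^ n * (\<integral>w. \<mu> w * cnj w ^ n \<partial>lebesgue_on unit_disk)" for n
    unfolding f_def by (rule integral_mult_right_zero)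
  ultimately show ?thesis by (simp add: mult_ac del: of_nat_Suc)
qed

text \<open>The integration by parts needs no explicit bounds; with the constant hidden, boundedness
  passes through sums and products by introduction rules.\<close>

definition bdd_on_disk :: "(complex \<Rightarrow> complex) \<Rightarrow> bool" where
  "bdd_on_disk f \<longleftrightarrow> (\<exists>K. \<forall>w\<in>unit_disk. norm (f w) \<le> K)"

lemma bdd_on_disk_const [intro, simp]: "bdd_on_disk (\<lambda>_. c)"
  by (auto simp: bdd_on_disk_def)

lemma bdd_on_disk_id [intro, simp]: "bdd_on_disk (\<lambda>w. w)"
  unfolding bdd_on_disk_def by (rule exI[of _ 1]) auto

lemma bdd_on_disk_cnj: "bdd_on_disk f \<Longrightarrow> bdd_on_disk (\<lambda>w. cnj (f w))"
  by (simp add: bdd_on_disk_def)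

lemma bdd_on_disk_add: "bdd_on_disk f \<Longrightarrow> bdd_on_disk g \<Longrightarrow> bdd_on_disk (\<lambda>w. f w + g w)"
  unfolding bdd_on_disk_def by (meson norm_triangle_le add_mono)

lemma bdd_on_disk_diff: "bdd_on_disk f \<Longrightarrow> bdd_on_disk g \<Longrightarrow> bdd_on_disk (\<lambda>w. f w - g w)"
  unfolding bdd_on_disk_def by (meson norm_triangle_le_diff add_mono)

lemma bdd_on_disk_minus: "bdd_on_disk f \<Longrightarrow> bdd_on_disk (\<lambda>w. - f w)"
  by (simp add: bdd_on_disk_def)

lemma bdd_on_disk_mult:
  assumes "bdd_on_disk f" "bdd_on_disk g"
  shows "bdd_on_disk (\<lambda>w. f w * g w)"
proof -
  obtain K L where KL: "\<And>w. w \<in> unit_disk \<Longrightarrow> norm (f w) \<le> K" "\<And>w. w \<in> unit_disk \<Longrightarrow> norm (g w) \<le> L"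
    using assms unfolding bdd_on_disk_def by blast
  have "norm (f w * g w) \<le> \<bar>K\<bar> * \<bar>L\<bar>" if "w \<in> unit_disk" for w
    unfolding norm_mult by (rule mult_mono) (use KL[OF that] in auto)
  then show ?thesis unfolding bdd_on_disk_def by blast
qed

lemma bdd_on_disk_power: "bdd_on_disk f \<Longrightarrow> bdd_on_disk (\<lambda>w. f w ^ n)"
  by (induction n) (auto intro: bdd_on_disk_mult)

lemmas bdd_on_disk_intros = bdd_on_disk_const bdd_on_disk_id bdd_on_disk_cnj bdd_on_disk_add
  bdd_on_disk_diff bdd_on_disk_minus bdd_on_disk_mult bdd_on_disk_power

text \<open>The factor \<open>1 - |w|^2\<close> supplies the vanishing on the circle, so
  \<open>F\<close> itself only has to be bounded.\<close>

lemma disk_integral_wirtinger_weighted_eq_0: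
  assumes d: "\<And>w. w \<in> unit_disk \<Longrightarrow> has_wirtinger (\<lambda>w. (1 - w * cnj w) * F w) (A w) (B w) w"
    and A: "continuous_on unit_disk A" "bdd_on_disk A"
    and B: "continuous_on unit_disk B" "bdd_on_disk B"
    and F: "bdd_on_disk F"
  shows "integral\<^sup>L (lebesgue_on unit_disk) A = 0" and "integral\<^sup>L (lebesgue_on unit_disk) B = 0"
proof -
  obtain K K' L where K: "\<And>w. w \<in> unit_disk \<Longrightarrow> norm (A w) \<le> K" "\<And>w. w \<in> unit_disk \<Longrightarrow> norm (B w) \<le> K'"
     and L: "\<And>w. w \<in> unit_disk \<Longrightarrow> norm (F w) \<le> L"
    using A(2) B(2) F unfolding bdd_on_disk_def by blast
  have *: "norm ((1 - w * cnj w) * F w) \<le> L * (1 - (norm w)\<^sup>2)" if "w \<in> unit_disk" for w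
  proof -
    have "1 - w * cnj w = of_real (1 - (norm w)\<^sup>2)" unfolding of_real_diff complex_norm_square by simp
    moreover have "(norm w)\<^sup>2 \<le> 1" using that by (intro power_le_one) auto
    ultimately have "norm ((1 - w * cnj w) * F w) = (1 - (norm w)\<^sup>2) * norm (F w)"
      by (simp only: norm_mult norm_of_real abs_of_nonneg diff_ge_0_iff_ge)
    also have "\<dots> \<le> (1 - (norm w)\<^sup>2) * L" using \<open>(norm w)\<^sup>2 \<le> 1\<close> L[OF that] by (intro mult_left_mono) auto
    finally show ?thesis by (simp add: mult.commute)
  qed
  show "integral\<^sup>L (lebesgue_on unit_disk) A = 0" "integral\<^sup>L (lebesgue_on unit_disk) B = 0"
    using disk_integral_wirtinger_eq_0[OF d A(1) K(1) B(1) K(2) *] by blast+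
qed

lemma has_wirtinger_eqI:
  "has_wirtinger f A' B' w \<Longrightarrow> A' = A \<Longrightarrow> B' = B \<Longrightarrow> has_wirtinger f A B w"
  by simp

lemma has_wirtinger_rho: "has_wirtinger (\<lambda>w. 1 - w * cnj w) (- cnj w) (- w) w"
  by (rule has_wirtinger_eqI, rule has_wirtinger_diff[OF has_wirtinger_const has_wirtinger_mult[OF has_wirtinger_id has_wirtinger_cnj_id]]) auto

lemma integrable_disk_bdd: "continuous_on unit_disk f \<Longrightarrow> bdd_on_disk f \<Longrightarrow> integrable (lebesgue_on unit_disk) f"
  unfolding bdd_on_disk_def by (erule exE, erule integrable_disk_continuous) (rule bspec)

text \<open>Stokes replaces polar coordinates. Applied to \<open>(1 - |w|^2) w^(k+1) cnj w^n\<close>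
  and to its mirror image with \<open>w^k cnj w^(n+1)\<close>, it gives
  \<open>(k+1) I = J (k+1) (n+1) = (n+1) I\<close>. Hence \<open>I = 0\<close> off the diagonal; on
  it, \<open>I\<close> is a difference of consecutive \<open>J\<close>, and the recursion starts
  from the area of the disk.\<close>

lemma disk_integral_monomials:
  "(\<integral>w. (1 - w * cnj w) * (w ^ k * cnj w ^ n) \<partial>lebesgue_on unit_disk) =
    (if k = n then of_real pi / of_nat ((n + 1) * (n + 2)) else 0)"
proof -
  define I where "I = (\<lambda>k n. \<integral>w. (1 - w * cnj w) * (w ^ k * cnj w ^ n) \<partial>lebesgue_on unit_disk)"
  define J where "J = (\<lambda>k n. \<integral>w. w ^ k * cnj w ^ n \<partial>lebesgue_on unit_disk)"
  have iI: "integrable (lebesgue_on unit_disk) (\<lambda>w. (1 - w * cnj w) * (w ^ k * cnj w ^ n))"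
    and iJ: "integrable (lebesgue_on unit_disk) (\<lambda>w. w ^ k * cnj w ^ n)" for k n
    by (intro integrable_disk_bdd continuous_intros bdd_on_disk_intros)+
  have IJ: "I k n = J k n - J (Suc k) (Suc n)" for k n
  proof -
    have "(\<lambda>w. (1 - w * cnj w) * (w ^ k * cnj w ^ n)) = (\<lambda>w. w ^ k * cnj w ^ n - w ^ Suc k * cnj w ^ Suc n)"
      by (rule ext) (simp add: algebra_simps)
    then show ?thesis unfolding I_def J_def using iJ by (simp del: power_Suc)
  qed
  have 1: "of_nat (Suc k) * I k n = J (Suc k) (Suc n)" for k n
  proof -
    define A where "A = (\<lambda>w. of_nat (Suc k) * ((1 - w * cnj w) * (w ^ k * cnj w ^ n)) - w ^ Suc k * cnj w ^ Suc n)"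
    define B where "B = (\<lambda>w. (- w) * (w ^ Suc k * cnj w ^ n) + (1 - w * cnj w) * (w ^ Suc k * (of_nat n * cnj w ^ (n - 1))))"
    have "has_wirtinger (\<lambda>w. (1 - w * cnj w) * (w ^ Suc k * cnj w ^ n)) (A w) (B w) w" for w
      by (rule has_wirtinger_eqI, rule has_wirtinger_mult[OF has_wirtinger_rho has_wirtinger_mult[OF has_wirtinger_power has_wirtinger_cnj_power]])
        (auto simp: A_def B_def algebra_simps)
    then have "integral\<^sup>L (lebesgue_on unit_disk) A = 0"
      by (rule disk_integral_wirtinger_weighted_eq_0(1)[where B = B])
        (unfold A_def B_def, (intro continuous_intros bdd_on_disk_intros)+)
    then show ?thesis unfolding A_def I_def J_def using iI iJ by (simp del: power_Suc of_nat_Suc)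
  qed
  have 2: "of_nat (Suc n) * I k n = J (Suc k) (Suc n)" for k n
  proof -
    define A where "A = (\<lambda>w. (- cnj w) * (w ^ k * cnj w ^ Suc n) + (1 - w * cnj w) * (of_nat k * w ^ (k - 1) * cnj w ^ Suc n))"
    define B where "B = (\<lambda>w. of_nat (Suc n) * ((1 - w * cnj w) * (w ^ k * cnj w ^ n)) - w ^ Suc k * cnj w ^ Suc n)"
    have "has_wirtinger (\<lambda>w. (1 - w * cnj w) * (w ^ k * cnj w ^ Suc n)) (A w) (B w) w" for w
      by (rule has_wirtinger_eqI, rule has_wirtinger_mult[OF has_wirtinger_rho has_wirtinger_mult[OF has_wirtinger_power has_wirtinger_cnj_power]])
        (auto simp: A_def B_def algebra_simps)
    then have "integral\<^sup>L (lebesgue_on unit_disk) B = 0"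
      by (rule disk_integral_wirtinger_weighted_eq_0(2)[where A = A])
        (unfold A_def B_def, (intro continuous_intros bdd_on_disk_intros)+)
    then show ?thesis unfolding B_def I_def J_def using iI iJ by (simp del: power_Suc of_nat_Suc)
  qed
  have "measure lebesgue unit_disk = pi"
    by (simp add: content_ball unit_ball_vol_2)
  then have J0: "J 0 0 = of_real pi"
    by (simp add: J_def measure_restrict_space space_restrict_space scaleR_conv_of_real)
  have J: "J n n = of_real pi / of_nat (n + 1)" for n
  proof (induction n)
    case (Suc n)
    have "of_nat (Suc n) * (J n n - J (Suc n) (Suc n)) = J (Suc n) (Suc n)"
      using 1[of n n] IJ by simp
    then have "of_nat (n + 2) * J (Suc n) (Suc n) = of_nat (Suc n) * J n n"
      by (simp add: algebra_simps)
    also have "\<dots> = of_real pi" by (simp add: Suc del: of_nat_Suc)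
    finally show ?case by (simp add: field_simps del: of_nat_Suc)
  qed (simp add: J0)
  show ?thesis
  proof (cases "k = n")
    case True
    have "of_nat (Suc n) * I n n = of_real pi / of_nat (n + 2)" using 1[of n n] J[of "Suc n"] by simp
    moreover have "(of_nat ((n + 1) * (n + 2)) :: complex) = of_nat (Suc n) * of_nat (n + 2)"
      unfolding of_nat_mult by simp
    ultimately have "I n n = of_real pi / of_nat ((n + 1) * (n + 2))"
      by (simp only:) (simp add: field_simps del: of_nat_Suc)
    then show ?thesis using True by (simp add: I_def)
  next
    case False
    have "of_nat (Suc k) * I k n = of_nat (Suc n) * I k n" unfolding 1 2 ..
    then have "I k n = 0" using False by (simp only: mult_cancel_right of_nat_eq_iff) simp
    then show ?thesis using False by (simp add: I_def)
  qed
qed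

text \<open>The Taylor series of \<open>g\<close> need not converge absolutely up to the circle, so
  the moments are computed for the dilations \<open>g (r w)\<close>. The limit as \<open>r\<close>
  tends to 1 is dominated because
  \<open>(1 - |w|^2) |g (r w)| \<le> (1 - |r w|^2) |g (r w)| \<le> 1\<close>.\<close>

lemma disk_integral_bergman_moment:
  fixes a :: "nat \<Rightarrow> complex"
  assumes g: "\<And>z. z \<in> unit_disk \<Longrightarrow> (\<lambda>n. a n * z ^ n) sums g z" and hol: "g holomorphic_on unit_disk"
    and bd: "\<And>w. w \<in> unit_disk \<Longrightarrow> (1 - (cmod w)\<^sup>2) * cmod (g w) \<le> 1"
  shows "(\<integral>w. (1 - w * cnj w) * g w * cnj w ^ n \<partial>lebesgue_on unit_disk) = a n * (of_real pi / of_nat ((n + 1) * (n + 2)))"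
    (is "?I = ?c")
proof -
  have rho: "cmod (1 - w * cnj w) = 1 - (cmod w)\<^sup>2" if "w \<in> unit_disk" for w
  proof -
    have "1 - w * cnj w = of_real (1 - (cmod w)\<^sup>2)" unfolding of_real_diff complex_norm_square by simp
    moreover have "(cmod w)\<^sup>2 \<le> 1" using that by (intro power_le_one) auto
    ultimately show ?thesis by (simp only: norm_of_real abs_of_nonneg diff_ge_0_iff_ge)
  qed
  have le1: "cmod (1 - w * cnj w) \<le> 1" if "w \<in> unit_disk" for w
    using rho[OF that] by simp
  have cn: "cmod (cnj w ^ n) \<le> 1" "cmod (w ^ n) \<le> 1" if "w \<in> unit_disk" for w n
    using that by (simp_all add: norm_power power_le_one)
  have dil: "(\<integral>w. (1 - w * cnj w) * g (of_real r * w) * cnj w ^ n \<partial>lebesgue_on unit_disk) = of_real r ^ n * ?c"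
    if r: "0 \<le> r" "r < 1" for r
  proof -
    define f where "f = (\<lambda>k w. a k * of_real r ^ k * ((1 - w * cnj w) * (w ^ k * cnj w ^ n)))"
    have int0: "integrable (lebesgue_on unit_disk) (\<lambda>w. (1 - w * cnj w) * (w ^ k * cnj w ^ n))" for k
      by (intro integrable_disk_bdd continuous_intros bdd_on_disk_intros)
    then have intf: "integrable (lebesgue_on unit_disk) (f k)" for k
      unfolding f_def by (rule integrable_mult_right)
    have s: "summable (\<lambda>k. cmod (a k) * r ^ k)"
      by (rule disk_series_abs_summable[OF sums_summable[OF g] r])
    have nf: "cmod (f k w) \<le> cmod (a k) * r ^ k" if w: "w \<in> unit_disk" for k w
    proof -
      have "cmod (1 - w * cnj w) * (cmod (w ^ k) * cmod (cnj w ^ n)) \<le> 1"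
        by (intro mult_le_one le1 cn w mult_nonneg_nonneg norm_ge_zero)
      then have "cmod (a k) * r ^ k * (cmod (1 - w * cnj w) * (cmod (w ^ k) * cmod (cnj w ^ n))) \<le> cmod (a k) * r ^ k"
        using r by (intro mult_left_le) auto
      then show ?thesis using r unfolding f_def by (simp only: norm_mult norm_power norm_of_real abs_of_nonneg)
    qed
    have "(\<lambda>k. integral\<^sup>L (lebesgue_on unit_disk) (f k)) sums (\<integral>w. (\<Sum>k. f k w) \<partial>lebesgue_on unit_disk)"
    proof (rule sums_integral[OF intf])
      show "AE w in lebesgue_on unit_disk. summable (\<lambda>k. cmod (f k w))"
        by (rule AE_I2, rule summable_comparison_test'[OF s]) (use nf in \<open>auto simp: space_restrict_space\<close>)
      have "(\<integral>w. cmod (f k w) \<partial>lebesgue_on unit_disk) \<le> cmod (a k) * r ^ k * measure (lebesgue_on unit_disk) (space (lebesgue_on unit_disk))" for k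
      proof -
        have "(\<integral>w. cmod (f k w) \<partial>lebesgue_on unit_disk) \<le> (\<integral>w. cmod (a k) * r ^ k \<partial>lebesgue_on unit_disk)"
          by (rule integral_mono) (use nf intf integrable_disk_bounded[of "\<lambda>_. cmod (a k) * r ^ k" "cmod (a k) * r ^ k"] r in \<open>auto simp: space_restrict_space\<close>)
        then show ?thesis by (simp add: mult_ac)
      qed
      then show "summable (\<lambda>k. \<integral>w. cmod (f k w) \<partial>lebesgue_on unit_disk)"
        by (intro summable_comparison_test'[OF summable_mult2[OF s, of "measure (lebesgue_on unit_disk) (space (lebesgue_on unit_disk))"]])
          simp
    qed
    moreover have "(\<integral>w. (\<Sum>k. f k w) \<partial>lebesgue_on unit_disk) = (\<integral>w. (1 - w * cnj w) * g (of_real r * w) * cnj w ^ n \<partial>lebesgue_on unit_disk)"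
    proof (rule Bochner_Integration.integral_cong[OF refl])
      fix w assume "w \<in> space (lebesgue_on unit_disk)"
      then have w: "cmod w < 1" by (simp add: space_restrict_space)
      have "of_real r * w \<in> unit_disk"
        using mult_strict_mono'[of r 1 "cmod w" 1] w r by (simp add: norm_mult)
      from sums_mult[OF g[OF this], of "(1 - w * cnj w) * cnj w ^ n"]
      have "(\<lambda>k. f k w) sums ((1 - w * cnj w) * g (of_real r * w) * cnj w ^ n)"
        by (simp add: f_def power_mult_distrib mult_ac)
      then show "(\<Sum>k. f k w) = (1 - w * cnj w) * g (of_real r * w) * cnj w ^ n" by (rule sums_unique[symmetric])
    qed
    moreover have "(\<lambda>k. integral\<^sup>L (lebesgue_on unit_disk) (f k)) sums (of_real r ^ n * ?c)"
    proof -
      have "integral\<^sup>L (lebesgue_on unit_disk) (f k) = (if k = n then of_real r ^ n * ?c else 0)" for k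
        unfolding f_def using disk_integral_monomials[of k n] by (subst integral_mult_right_zero) simp
      then show ?thesis using sums_single[of n "\<lambda>_. of_real r ^ n * ?c"] by simp
    qed
    ultimately show ?thesis by (simp add: sums_iff)
  qed
  define r where "r = (\<lambda>i. real i / real (Suc i))"
  have r: "0 \<le> r i" "r i < 1" for i by (auto simp: r_def)
  have rlim: "r \<longlonglongrightarrow> 1" unfolding r_def by (rule LIMSEQ_n_over_Suc_n)
  have cg: "continuous_on unit_disk g" using hol by (rule holomorphic_on_imp_continuous_on)
  have rD: "of_real (r i) * w \<in> unit_disk" if "w \<in> unit_disk" for i w
    using mult_strict_mono'[of "r i" 1 "cmod w" 1] r[of i] that by (simp add: norm_mult)
  have "(\<lambda>i. \<integral>w. (1 - w * cnj w) * g (of_real (r i) * w) * cnj w ^ n \<partial>lebesgue_on unit_disk) \<longlonglongrightarrow> ?I"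
  proof (rule integral_dominated_convergence[where w = "\<lambda>_. 1"])
    show "(\<lambda>w. (1 - w * cnj w) * g w * cnj w ^ n) \<in> borel_measurable (lebesgue_on unit_disk)"
      by (intro continuous_imp_measurable_on_sets_lebesgue continuous_intros cg) auto
    show "(\<lambda>w. (1 - w * cnj w) * g (of_real (r i) * w) * cnj w ^ n) \<in> borel_measurable (lebesgue_on unit_disk)" for i
      by (intro continuous_imp_measurable_on_sets_lebesgue continuous_intros continuous_on_compose2[OF cg])
        (use rD in auto)
    show "integrable (lebesgue_on unit_disk) (\<lambda>_. 1::real)"
      by (rule integrable_disk_bounded[of _ 1]) auto
    show "AE w in lebesgue_on unit_disk. (\<lambda>i. (1 - w * cnj w) * g (of_real (r i) * w) * cnj w ^ n) \<longlonglongrightarrow> (1 - w * cnj w) * g w * cnj w ^ n"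
    proof (rule AE_I2)
      fix w assume "w \<in> space (lebesgue_on unit_disk)"
      then have w: "w \<in> unit_disk" by (simp add: space_restrict_space)
      have "isCont g w" using cg w by (simp add: continuous_on_eq_continuous_at)
      moreover have "(\<lambda>i. of_real (r i) * w) \<longlonglongrightarrow> of_real 1 * w" by (intro tendsto_intros rlim)
      ultimately have "(\<lambda>i. g (of_real (r i) * w)) \<longlonglongrightarrow> g w"
        by (intro isCont_tendsto_compose[of w g]) auto
      then show "(\<lambda>i. (1 - w * cnj w) * g (of_real (r i) * w) * cnj w ^ n) \<longlonglongrightarrow> (1 - w * cnj w) * g w * cnj w ^ n"
        by (intro tendsto_intros)
    qed
    show "AE w in lebesgue_on unit_disk. norm ((1 - w * cnj w) * g (of_real (r i) * w) * cnj w ^ n) \<le> 1" for i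
    proof (rule AE_I2)
      fix w assume "w \<in> space (lebesgue_on unit_disk)"
      then have w: "w \<in> unit_disk" by (simp add: space_restrict_space)
      have "cmod (of_real (r i) * w) \<le> cmod w"
        using r[of i] by (simp add: norm_mult mult_left_le_one_le)
      then have "(cmod (of_real (r i) * w))\<^sup>2 \<le> (cmod w)\<^sup>2" by (rule power_mono) simp
      then have "cmod (1 - w * cnj w) * cmod (g (of_real (r i) * w)) \<le> (1 - (cmod (of_real (r i) * w))\<^sup>2) * cmod (g (of_real (r i) * w))"
        unfolding rho[OF w] by (intro mult_right_mono) auto
      also have "\<dots> \<le> 1" by (rule bd[OF rD[OF w]])
      finally show "norm ((1 - w * cnj w) * g (of_real (r i) * w) * cnj w ^ n) \<le> 1"
        unfolding norm_mult by (intro mult_le_one[OF _ _ cn(1)[OF w]]) auto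
    qed
  qed
  moreover have "(\<lambda>i. of_real (r i) ^ n * ?c) \<longlonglongrightarrow> of_real 1 ^ n * ?c"
    by (intro tendsto_intros rlim)
  ultimately show ?thesis
    unfolding dil[OF r] using LIMSEQ_unique by fastforce
qed

text \<open>Cauchy's estimate on the circle of radius \<open>(1 - |w|)/2\<close>, where
  \<open>|g|\<close> is at most \<open>2 / (1 - |w|)\<close>. The cases \<open>k = 0, 1, 2\<close>
  bound \<open>m\<close> and the weighted \<open>g'\<close> and \<open>g''\<close>, as Stokes'
  theorem requires.\<close>

lemma bloch_cauchy_bound:
  assumes hol: "g holomorphic_on unit_disk"
    and bd: "\<And>w. w \<in> unit_disk \<Longrightarrow> (1 - (cmod w)\<^sup>2) * cmod (g w) \<le> 1"
  shows "bdd_on_disk (\<lambda>w. (1 - w * cnj w) ^ Suc k * (deriv ^^ k) g w)"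
proof -
  have "cmod ((1 - w * cnj w) ^ Suc k * (deriv ^^ k) g w) \<le> fact k * 4 ^ Suc k" if w: "w \<in> unit_disk" for w
  proof -
    define \<delta> where "\<delta> = 1 - cmod w"
    have \<delta>: "0 < \<delta>" "\<delta> \<le> 1" using w by (auto simp: \<delta>_def)
    have sub: "cball w (\<delta>/2) \<subseteq> unit_disk"
    proof
      fix x assume "x \<in> cball w (\<delta>/2)"
      then have "cmod (x - w) \<le> \<delta>/2" by (simp add: dist_norm norm_minus_commute)
      then have "cmod x \<le> cmod w + \<delta>/2" using norm_triangle_sub[of x w] by linarith
      also have "cmod w + \<delta>/2 < cmod w + \<delta>" using \<delta> by simp
      finally show "x \<in> unit_disk" by (simp add: \<delta>_def)
    qed
    have "norm ((deriv ^^ k) g w) \<le> fact k * (2 / \<delta>) / (\<delta>/2) ^ k"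
    proof (rule Cauchy_inequality)
      show "g holomorphic_on ball w (\<delta>/2)"
        using hol sub by (meson holomorphic_on_subset ball_subset_cball order_trans)
      show "continuous_on (cball w (\<delta>/2)) g"
        using hol sub by (meson holomorphic_on_imp_continuous_on continuous_on_subset)
      fix x assume x: "norm (w - x) = \<delta>/2"
      have xD: "x \<in> unit_disk" using sub x by (auto simp: dist_norm)
      have "cmod x \<le> cmod w + \<delta>/2" using norm_triangle_sub[of x w] x by (simp add: norm_minus_commute)
      then have "\<delta>/2 \<le> 1 - cmod x" by (simp add: \<delta>_def field_simps)
      also have "\<dots> \<le> 1 - (cmod x)\<^sup>2" using xD by (simp add: power2_eq_square mult_left_le)
      finally have "\<delta>/2 * cmod (g x) \<le> (1 - (cmod x)\<^sup>2) * cmod (g x)" by (rule mult_right_mono) simp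
      also have "\<dots> \<le> 1" by (rule bd[OF xD])
      finally show "norm (g x) \<le> 2 / \<delta>" using \<delta> by (simp add: field_simps)
    qed (use \<delta> in simp)
    moreover have "cmod (1 - w * cnj w) \<le> 2 * \<delta>"
    proof -
      have eq: "1 - w * cnj w = of_real (1 - (cmod w)\<^sup>2)" unfolding of_real_diff complex_norm_square by simp
      have "1 - (cmod w)\<^sup>2 = \<delta> * (1 + cmod w)" by (simp add: \<delta>_def power2_eq_square algebra_simps)
      also have "\<dots> \<le> \<delta> * 2" using \<delta> w by (intro mult_left_mono) auto
      finally have "1 - (cmod w)\<^sup>2 \<le> 2 * \<delta>" by simp
      moreover have "(cmod w)\<^sup>2 \<le> 1" using w by (intro power_le_one) auto
      ultimately show ?thesis unfolding eq norm_of_real by simp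
    qed
    then have "cmod (1 - w * cnj w) ^ Suc k \<le> (2 * \<delta>) ^ Suc k" by (rule power_mono) simp
    ultimately have "cmod (1 - w * cnj w) ^ Suc k * cmod ((deriv ^^ k) g w) \<le> (2 * \<delta>) ^ Suc k * (fact k * (2 / \<delta>) / (\<delta>/2) ^ k)"
      using \<delta> by (intro mult_mono) auto
    also have "\<dots> = fact k * 4 ^ Suc k"
    proof -
      have "(2 * \<delta>) ^ Suc k / (\<delta> / 2) ^ Suc k = 4 ^ Suc k"
        unfolding power_divide[symmetric] using \<delta> by simp
      then show ?thesis using \<delta> by (simp add: field_simps)
    qed
    finally show ?thesis by (simp only: norm_mult norm_power)
  qed
  then show ?thesis unfolding bdd_on_disk_def by blast
qed

subsection \<open>Representing Bloch functions by densities of norm less than 1\<close>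

text \<open>For \<open>g = b'\<close> and the disk automorphism \<open>\<phi>\<close> with \<open>\<phi> 0 = w\<close> and \<open>\<phi>' 0 > 0\<close>, these are the
  first and second derivatives of \<open>b \<circ> \<phi>\<close> at 0.\<close>

definition bloch_m :: "(complex \<Rightarrow> complex) \<Rightarrow> complex \<Rightarrow> complex" where
  "bloch_m g w = (1 - w * cnj w) * g w"

definition bloch_n :: "(complex \<Rightarrow> complex) \<Rightarrow> complex \<Rightarrow> complex" where
  "bloch_n g w = (1 - w * cnj w)\<^sup>2 * deriv g w - 2 * cnj w * bloch_m g w"

text \<open>This is \<open>\<partial>/\<partial>w\<close> of \<open>(1 - |w|\<^sup>2) m\<^sup>2 cnj n\<close>. The term \<open>- 2 m |m|\<^sup>2\<close>, which comes from the curvature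
  of the disk, is what shrinks \<open>m\<close> where \<open>|m|\<close> is close to 1.\<close>

definition bloch_corr :: "(complex \<Rightarrow> complex) \<Rightarrow> complex \<Rightarrow> complex" where
  "bloch_corr g w = 2 * bloch_m g w * (bloch_n g w * cnj (bloch_n g w))
     - 2 * bloch_m g w * (bloch_m g w * cnj (bloch_m g w)) - cnj w * (bloch_m g w)\<^sup>2 * cnj (bloch_n g w)"

text \<open>Since \<open>cnj w ^ j\<close> has no \<open>w\<close>-derivative,
  \<open>bloch_corr g w * cnj w ^ j\<close> is again a \<open>w\<close>-derivative of a function
  vanishing on the circle. Thus all moments seen by the Bergman projection are 0.\<close>

lemma disk_integral_bloch_corr:
  assumes hol: "g holomorphic_on unit_disk"
    and bd: "\<And>w. w \<in> unit_disk \<Longrightarrow> (1 - (cmod w)\<^sup>2) * cmod (g w) \<le> 1"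
  shows "bdd_on_disk (bloch_corr g)" "continuous_on unit_disk (bloch_corr g)"
    and "(\<integral>w. bloch_corr g w * cnj w ^ j \<partial>lebesgue_on unit_disk) = 0"
proof -
  define R where "R = (\<lambda>w. 1 - w * cnj w)"
  define m where "m = bloch_m g"
  define n where "n = bloch_n g"
  define p where "p = (\<lambda>w. (R w)\<^sup>2 * deriv g w)"
  define s where "s = (\<lambda>w. (R w)^3 * deriv (deriv g) w)"
  have n_eq: "n = (\<lambda>w. p w - 2 * cnj w * m w)" unfolding n_def bloch_n_def p_def R_def m_def ..
  have m_eq: "m = (\<lambda>w. R w * g w)" unfolding m_def bloch_m_def R_def ..
  have h1: "deriv g holomorphic_on unit_disk" by (rule holomorphic_deriv[OF hol]) simp
  have h2: "deriv (deriv g) holomorphic_on unit_disk" by (rule holomorphic_deriv[OF h1]) simp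
  note [continuous_intros] = holomorphic_on_imp_continuous_on[OF hol] holomorphic_on_imp_continuous_on[OF h1]
    holomorphic_on_imp_continuous_on[OF h2]
  have R_cont [continuous_intros]: "continuous_on unit_disk R" unfolding R_def by (intro continuous_intros)
  have [continuous_intros]: "continuous_on unit_disk p" "continuous_on unit_disk s" "continuous_on unit_disk m"
    unfolding p_def s_def m_eq by (intro continuous_intros)+
  then have [continuous_intros]: "continuous_on unit_disk n"
    unfolding n_eq by (intro continuous_intros)
  have bm: "bdd_on_disk m" using bloch_cauchy_bound[OF hol bd, of 0] by (simp add: m_eq R_def)
  have bp: "bdd_on_disk p" using bloch_cauchy_bound[OF hol bd, of 1] by (simp add: p_def R_def power2_eq_square)
  have bs: "bdd_on_disk s" using bloch_cauchy_bound[OF hol bd, of 2]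
    by (simp add: s_def R_def eval_nat_numeral)
  have bR: "bdd_on_disk R" unfolding R_def by (intro bdd_on_disk_intros)
  have bn: "bdd_on_disk n" unfolding n_eq by (intro bdd_on_disk_intros bm bp)
  have corr: "bloch_corr g = (\<lambda>w. 2 * m w * (n w * cnj (n w)) - 2 * m w * (m w * cnj (m w)) - cnj w * (m w)\<^sup>2 * cnj (n w))"
    unfolding m_def n_def bloch_corr_def ..
  show bc: "bdd_on_disk (bloch_corr g)" unfolding corr by (intro bdd_on_disk_intros bm bn)
  show cc: "continuous_on unit_disk (bloch_corr g)" unfolding corr by (intro continuous_intros)
  define A where "A = (\<lambda>w. bloch_corr g w * cnj w ^ j)"
  \<comment> \<open>The derivative in \<open>cnj w\<close> brings in the conjugate of
    \<open>g''\<close> through \<open>s\<close>; it enters only as a bounded continuous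
    function.\<close>
  define B where "B = (\<lambda>w. (m w)\<^sup>2 * (cnj (s w) - 4 * w * cnj (p w) + 2 * w\<^sup>2 * cnj (m w) - 3 * w * cnj (n w)) * cnj w ^ j
     + R w * ((m w)\<^sup>2 * cnj (n w) * (of_nat j * cnj w ^ (j - 1))))"
  have d: "has_wirtinger (\<lambda>w. (1 - w * cnj w) * (m w * m w * cnj (n w) * cnj w ^ j)) (A w) (B w) w"
    if w: "w \<in> unit_disk" for w
  proof -
    have dg: "has_wirtinger g (deriv g w) 0 w" "has_wirtinger (deriv g) (deriv (deriv g) w) 0 w"
      using w hol h1 by (auto intro!: has_wirtinger_field holomorphic_derivI[of _ unit_disk])
    have dR: "has_wirtinger R (- cnj w) (- w) w" unfolding R_def by (rule has_wirtinger_rho)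
    \<comment> \<open>Derivatives are recorded after multiplication by \<open>R\<close>: the
      products are polynomials in \<open>w\<close>, the bounded \<open>m\<close>, \<open>n\<close>,
      \<open>p\<close>, \<open>s\<close> and their conjugates. The weight in front of the integrated
      function provides this \<open>R\<close>.\<close>
    obtain mA mB where dm: "has_wirtinger m mA mB w" and mA: "R w * mA = n w + cnj w * m w" and mB: "R w * mB = - w * m w"
    proof
      show "has_wirtinger m (- cnj w * g w + R w * deriv g w) (- w * g w + R w * 0) w"
        unfolding m_eq by (rule has_wirtinger_mult[OF dR dg(1)])
      show "R w * (- cnj w * g w + R w * deriv g w) = n w + cnj w * m w"
        by (simp add: n_eq m_eq p_def algebra_simps power2_eq_square)
      show "R w * (- w * g w + R w * 0) = - w * m w" by (simp add: m_eq)
    qed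
    \<comment> \<open>The summand \<open>- 2 * cnj (m w)\<close> of \<open>R w * nA\<close>,
      multiplied by \<open>m^2\<close>, is the origin of the term \<open>- 2 m |m|^2\<close> in
      \<open>bloch_corr\<close>.\<close>
    obtain nA nB where dn: "has_wirtinger (\<lambda>w. cnj (n w)) nA nB w"
      and nA: "R w * nA = - 2 * cnj (m w) - 2 * cnj w * cnj (n w)"
      and nB: "R w * nB = cnj (s w) - 4 * w * cnj (p w) + 2 * w\<^sup>2 * cnj (m w)"
    proof
      define P where "P = (- cnj w * R w + R w * - cnj w) * deriv g w + (R w * R w) * deriv (deriv g) w - ((0 * cnj w + 2 * 0) * m w + 2 * cnj w * mA)"
      define Q where "Q = (- w * R w + R w * - w) * deriv g w + (R w * R w) * 0 - ((0 * cnj w + 2 * 1) * m w + 2 * cnj w * mB)"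
      have "has_wirtinger n P Q w"
        unfolding n_eq p_def P_def Q_def power2_eq_square
        by (intro has_wirtinger_diff has_wirtinger_mult dR dg dm has_wirtinger_const has_wirtinger_cnj_id)
      then show "has_wirtinger (\<lambda>w. cnj (n w)) (cnj Q) (cnj P) w" by (rule has_wirtinger_cnj)
      have "R w * Q = - 2 * m w - 2 * w * n w"
      proof -
        have "R w * Q = - 2 * w * p w - 2 * R w * m w - 2 * cnj w * (R w * mB)"
          by (simp add: Q_def p_def power2_eq_square algebra_simps)
        then show ?thesis unfolding mB by (simp add: n_eq R_def algebra_simps)
      qed
      from arg_cong[OF this, of cnj] show "R w * cnj Q = - 2 * cnj (m w) - 2 * cnj w * cnj (n w)"
        by (simp add: R_def mult.commute)
      have "R w * P = s w - 4 * cnj w * p w + 2 * (cnj w)\<^sup>2 * m w"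
      proof -
        have "R w * P = s w - 2 * cnj w * p w - 2 * cnj w * (R w * mA)"
          by (simp add: P_def p_def s_def power2_eq_square power3_eq_cube algebra_simps)
        then show ?thesis unfolding mA by (simp add: n_eq algebra_simps power2_eq_square)
      qed
      from arg_cong[OF this, of cnj] show "R w * cnj P = cnj (s w) - 4 * w * cnj (p w) + 2 * w\<^sup>2 * cnj (m w)"
        by (simp add: R_def mult.commute)
    qed
    have dc: "has_wirtinger (\<lambda>w. cnj w ^ j) 0 (of_nat j * cnj w ^ (j - 1)) w" by (rule has_wirtinger_cnj_power)
    have prod: "- v * (x * x * y * c) + r * (((x1 * x + x * x1) * y + x * x * y1) * c + x * x * y * c1)
      = (- v * x * x * y + 2 * (r * x1) * x * y + x * x * (r * y1)) * c + r * (x\<^sup>2 * y * c1)"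
      for v x y c r x1 y1 c1 :: complex
      by (simp add: algebra_simps power2_eq_square)
    show ?thesis
    proof (rule has_wirtinger_eqI)
      show "has_wirtinger (\<lambda>w. (1 - w * cnj w) * (m w * m w * cnj (n w) * cnj w ^ j))
        (- cnj w * (m w * m w * cnj (n w) * cnj w ^ j) + (1 - w * cnj w) * (((mA * m w + m w * mA) * cnj (n w) + m w * m w * nA) * cnj w ^ j + m w * m w * cnj (n w) * 0))
        (- w * (m w * m w * cnj (n w) * cnj w ^ j) + (1 - w * cnj w) * (((mB * m w + m w * mB) * cnj (n w) + m w * m w * nB) * cnj w ^ j + m w * m w * cnj (n w) * (of_nat j * cnj w ^ (j - 1)))) w"
        by (intro has_wirtinger_mult dm dn dc has_wirtinger_rho)
      show "- cnj w * (m w * m w * cnj (n w) * cnj w ^ j) + (1 - w * cnj w) * (((mA * m w + m w * mA) * cnj (n w) + m w * m w * nA) * cnj w ^ j + m w * m w * cnj (n w) * 0) = A w"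
        unfolding prod unfolding R_def[symmetric, THEN fun_cong, of w] mA nA A_def corr
        by (simp add: algebra_simps power2_eq_square)
      show "- w * (m w * m w * cnj (n w) * cnj w ^ j) + (1 - w * cnj w) * (((mB * m w + m w * mB) * cnj (n w) + m w * m w * nB) * cnj w ^ j + m w * m w * cnj (n w) * (of_nat j * cnj w ^ (j - 1))) = B w"
        unfolding prod unfolding R_def[symmetric, THEN fun_cong, of w] mB nB B_def
        by (simp add: algebra_simps power2_eq_square)
    qed
  qed
  show "(\<integral>w. bloch_corr g w * cnj w ^ j \<partial>lebesgue_on unit_disk) = 0"
  proof (rule disk_integral_wirtinger_weighted_eq_0(1)[OF d, unfolded A_def])
    show "continuous_on unit_disk (\<lambda>w. bloch_corr g w * cnj w ^ j)" by (intro continuous_intros cc)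
    show "bdd_on_disk (\<lambda>w. bloch_corr g w * cnj w ^ j)" by (intro bdd_on_disk_intros bc)
    show "continuous_on unit_disk B" unfolding B_def by (intro continuous_intros)
    show "bdd_on_disk B" unfolding B_def by (intro bdd_on_disk_intros bm bn bp bs bR)
    show "bdd_on_disk (\<lambda>w. m w * m w * cnj (n w) * cnj w ^ j)" by (intro bdd_on_disk_intros bm bn)
  qed
qed

text \<open>The density is \<open>m\<close> plus 1/4000 of the correction, which lowers the norm and
  leaves all moments alone. The moment \<open>(n+1) a (n+1) pi / ((n+1) (n+2))\<close> of
  \<open>m\<close>, times the kernel coefficient \<open>(n+1) / pi\<close>, yields the factor
  \<open>(n+1)/(n+2)\<close>.\<close>

lemma bloch_representation:
  fixes a :: "nat \<Rightarrow> complex"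
  assumes b: "\<And>z. z \<in> unit_disk \<Longrightarrow> (\<lambda>n. a n * z ^ n) sums b z" and hol: "b holomorphic_on unit_disk"
    and bd: "\<And>w. w \<in> unit_disk \<Longrightarrow> (1 - (cmod w)\<^sup>2) * cmod (deriv b w) \<le> 1"
  obtains \<mu> where "\<mu> \<in> borel_measurable (lebesgue_on unit_disk)"
    and "\<And>w. w \<in> unit_disk \<Longrightarrow> cmod (\<mu> w) \<le> 1 - 1/10000"
    and "\<And>z. z \<in> unit_disk \<Longrightarrow> (\<lambda>n. of_real (real (n + 1) / real (n + 2)) * a (Suc n) * z ^ n) sums bergman_projection \<mu> z"
proof
  define g where "g = deriv b"
  have ghol: "g holomorphic_on unit_disk" unfolding g_def by (rule holomorphic_deriv[OF hol]) simp
  have gbd: "(1 - (cmod w)\<^sup>2) * cmod (g w) \<le> 1" if "w \<in> unit_disk" for w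
    unfolding g_def by (rule bd[OF that])
  have gs: "(\<lambda>n. diffs a n * z ^ n) sums g z" if "z \<in> unit_disk" for z
    unfolding g_def by (rule disk_series_deriv(1)[OF b that])
  define \<mu> where "\<mu> = (\<lambda>w. bloch_m g w + of_real (1/4000) * bloch_corr g w)"
  note corr = disk_integral_bloch_corr[OF ghol gbd]
  have cm: "continuous_on unit_disk (bloch_m g)"
    unfolding bloch_m_def[abs_def] by (intro continuous_intros holomorphic_on_imp_continuous_on ghol)
  show meas: "\<mu> \<in> borel_measurable (lebesgue_on unit_disk)"
    unfolding \<mu>_def by (intro continuous_imp_measurable_on_sets_lebesgue continuous_intros cm corr(2)) auto
  show bound: "cmod (\<mu> w) \<le> 1 - 1/10000" if w: "w \<in> unit_disk" for w
  proof -
    have R: "1 - w * cnj w = of_real (1 - (cmod w)\<^sup>2)" unfolding of_real_diff complex_norm_square by simp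
    have w1: "(cmod w)\<^sup>2 \<le> 1" using w by (intro power_le_one) auto
    have m: "cmod (bloch_m g w) = (1 - (cmod w)\<^sup>2) * cmod (g w)"
      unfolding bloch_m_def R norm_mult norm_of_real using w1 by simp
    show ?thesis
      unfolding \<mu>_def bloch_corr_def
    proof (rule correction_pointwise_bound)
      show "cmod (bloch_m g w) \<le> 1" unfolding m by (rule gbd[OF w])
      show "cmod w \<le> 1" using w by simp
      have n: "bloch_n g w = of_real ((1 - (cmod w)\<^sup>2)\<^sup>2) * deriv g w - 2 * cnj w * of_real (1 - (cmod w)\<^sup>2) * g w"
        unfolding bloch_n_def bloch_m_def R by simp
      show "1/5 * cmod (bloch_n g w) \<le> 1 / (1 - (1/5)\<^sup>2) - (1 - (1/5)\<^sup>2) * (cmod (bloch_m g w))\<^sup>2"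
        unfolding n m using bloch_second_derivative_bound[OF ghol gbd w, of "1/5"] by simp
    qed
  qed
  have moment: "(\<integral>w. \<mu> w * cnj w ^ n \<partial>lebesgue_on unit_disk) = diffs a n * (of_real pi / of_nat ((n + 1) * (n + 2)))" for n
  proof -
    have bm: "bdd_on_disk (bloch_m g)"
      using bloch_cauchy_bound[OF ghol gbd, of 0] by (simp add: bloch_m_def[abs_def])
    have "integrable (lebesgue_on unit_disk) (\<lambda>w. bloch_m g w * cnj w ^ n)"
      "integrable (lebesgue_on unit_disk) (\<lambda>w. bloch_corr g w * cnj w ^ n)"
      by (intro integrable_disk_bdd continuous_intros bdd_on_disk_intros cm bm corr)+
    then have "(\<integral>w. \<mu> w * cnj w ^ n \<partial>lebesgue_on unit_disk) = (\<integral>w. bloch_m g w * cnj w ^ n \<partial>lebesgue_on unit_disk)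
        + of_real (1/4000) * (\<integral>w. bloch_corr g w * cnj w ^ n \<partial>lebesgue_on unit_disk)"
      by (simp add: \<mu>_def ring_distribs mult.assoc)
    then show ?thesis
      using disk_integral_bergman_moment[OF gs ghol gbd] corr(3) by (simp add: bloch_m_def)
  qed
  show "(\<lambda>n. of_real (real (n + 1) / real (n + 2)) * a (Suc n) * z ^ n) sums bergman_projection \<mu> z"
    if z: "z \<in> unit_disk" for z
  proof -
    have "of_nat (Suc n) * (diffs a n * (of_real pi / of_nat ((n + 1) * (n + 2))) / of_real pi)
        = of_real (real (n + 1) / real (n + 2)) * a (Suc n)" for n
    proof -
      have "of_nat (Suc n) * ((of_nat (Suc n) * x) * (of_real pi / (of_nat (Suc n) * y)) / of_real pi)
        = of_nat (Suc n) / y * x" if "y \<noteq> 0" for x y :: complex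
        using that by (simp add: field_simps del: of_nat_Suc)
      moreover have "(of_nat ((n + 1) * (n + 2)) :: complex) = of_nat (Suc n) * of_nat (n + 2)"
        unfolding of_nat_mult by simp
      moreover have "(of_nat (n + 2) :: complex) \<noteq> 0" unfolding of_nat_eq_0_iff by simp
      ultimately have "of_nat (Suc n) * (diffs a n * (of_real pi / of_nat ((n + 1) * (n + 2))) / of_real pi)
        = of_nat (Suc n) / of_nat (n + 2) * a (Suc n)"
        unfolding diffs_def by (simp only: simp_thms)
      then show ?thesis by simp
    qed
    then show ?thesis
      using bergman_projection_sums[OF meas bound z] unfolding moment by simp
  qed
qed

subsection \<open>Comparison of asymptotic variances\<close>

lemma tendsto_const_plus_over_log:
  "((\<lambda>r. c + K / - ln (1 - r)) \<longlongrightarrow> c) (at_left (1::real))"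
  by real_asymp

text \<open>Additive constants, and with them finitely many Taylor coefficients, are invisible to
  the asymptotic variance.\<close>

lemma Limsup_le_if_log_error:
  fixes f :: "real \<Rightarrow> real"
  assumes "\<forall>\<^sub>F r in at_left 1. f r \<le> c + K / - ln (1 - r)"
  shows "Limsup (at_left 1) (\<lambda>r. ereal (f r)) \<le> ereal c"
proof -
  have "Limsup (at_left 1) (\<lambda>r. ereal (f r)) \<le> Limsup (at_left 1) (\<lambda>r. ereal (c + K / - ln (1 - r)))"
    by (rule Limsup_mono) (use assms in \<open>auto elim: eventually_mono\<close>)
  also have "\<dots> = ereal c"
    by (rule lim_imp_Limsup[OF _ tendsto_ereal[OF tendsto_const_plus_over_log]])
      (simp add: trivial_limit_at_left_real)
  finally show ?thesis .
qed

lemma coeff_mean_nonneg: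
  assumes "\<And>z. z \<in> unit_disk \<Longrightarrow> summable (\<lambda>n. a n * z ^ n)" "0 \<le> t" "t < 1"
  shows "0 \<le> coeff_mean a t"
  unfolding coeff_mean_def by (rule suminf_nonneg[OF coeff_mean_summable[OF assms]]) (use assms in auto)

lemma bloch_norm_le_1D:
  assumes "bloch_norm b \<le> 1" "z \<in> unit_disk"
  shows "(1 - (cmod z)\<^sup>2) * cmod (deriv b z) \<le> 1"
proof -
  have "ereal ((1 - (cmod z)\<^sup>2) * cmod (deriv b z)) \<le> bloch_norm b"
    unfolding bloch_norm_def by (rule SUP_upper[OF assms(2)])
  also have "\<dots> \<le> 1" by (rule assms(1))
  finally show ?thesis by simp
qed

lemma bloch_asymptotic_variance_le:
  fixes a :: "nat \<Rightarrow> complex"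
  assumes b: "\<And>z. z \<in> unit_disk \<Longrightarrow> (\<lambda>n. a n * z ^ n) sums b z" and hol: "b holomorphic_on unit_disk"
    and bd: "\<And>z. z \<in> unit_disk \<Longrightarrow> (1 - (cmod z)\<^sup>2) * cmod (deriv b z) \<le> 1"
  shows "asymptotic_variance b \<le> ereal (177/200)"
proof (subst asymptotic_variance_eq[OF b], assumption, rule Limsup_le_if_log_error)
  define K where "K = (cmod (a 0))\<^sup>2 + 19/200 * (cmod (a 1))\<^sup>2"
  show "\<forall>\<^sub>F r in at_left 1. r * coeff_mean a (r\<^sup>2) / - ln (1 - r) \<le> 177/200 + K / - ln (1 - r)"
  proof (rule eventually_at_leftI[of 0])
    fix r :: real assume "r \<in> {0<..<1}"
    then have r: "0 < r" "r < 1" by auto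
    have r2: "0 \<le> r\<^sup>2" "r\<^sup>2 < 1" using r by (auto simp: power_less_one_iff)
    have l: "- ln (1 - r) > 0" using r by simp
    have "r * coeff_mean a (r\<^sup>2) \<le> coeff_mean a (r\<^sup>2)"
      using r r2 coeff_mean_nonneg[OF sums_summable[OF b] r2] by (intro mult_left_le_one_le) auto
    also have "\<dots> \<le> 177/200 * - ln (1 - r\<^sup>2) + K"
      using bloch_coeff_mean_bound[OF b hol bd r2] by (simp add: K_def)
    also have "- ln (1 - r\<^sup>2) \<le> - ln (1 - r)"
      using r r2 by (simp add: power2_eq_square mult_left_le)
    finally have "r * coeff_mean a (r\<^sup>2) \<le> 177/200 * - ln (1 - r) + K" by simp
    then have "r * coeff_mean a (r\<^sup>2) / - ln (1 - r) \<le> (177/200 * - ln (1 - r) + K) / - ln (1 - r)"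
      by (rule divide_right_mono) (use l in simp)
    also have "\<dots> = 177/200 + K / - ln (1 - r)" using l by (subst add_divide_distrib) simp
    finally show "r * coeff_mean a (r\<^sup>2) / - ln (1 - r) \<le> 177/200 + K / - ln (1 - r)" .
  qed simp
qed

text \<open>The coefficient \<open>d n\<close> is matched with \<open>a (n+1)\<close>, as after
  division by \<open>z\<close>. Indices below \<open>N\<close>, where the comparison may fail, go
  into the additive constant.\<close>

lemma coeff_mean_shift_le:
  fixes a :: "nat \<Rightarrow> complex" and q :: real
  assumes a: "\<And>z. z \<in> unit_disk \<Longrightarrow> summable (\<lambda>n. a n * z ^ n)"
    and d: "\<And>z. z \<in> unit_disk \<Longrightarrow> summable (\<lambda>n. d n * z ^ n)"
    and q: "0 \<le> q" and le: "\<And>n. n \<ge> N \<Longrightarrow> (cmod (a (Suc n)))\<^sup>2 \<le> q * (cmod (d n))\<^sup>2"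
    and t: "0 \<le> t" "t < 1"
  shows "coeff_mean a t \<le> ((cmod (a 0))\<^sup>2 + (\<Sum>n<N. (cmod (a (Suc n)))\<^sup>2)) + q * coeff_mean d t"
proof -
  have sa: "summable (\<lambda>n. (cmod (a n))\<^sup>2 * t ^ n)" and sd: "summable (\<lambda>n. (cmod (d n))\<^sup>2 * t ^ n)"
    by (rule coeff_mean_summable[OF a t] coeff_mean_summable[OF d t]; assumption)+
  define e where "e = (\<lambda>n. if n \<in> {..<N} then (cmod (a (Suc n)))\<^sup>2 else 0)"
  have e: "e sums (\<Sum>n<N. (cmod (a (Suc n)))\<^sup>2)"
    unfolding e_def by (rule sums_If_finite_set) simp
  have le': "(cmod (a (Suc n)))\<^sup>2 * t ^ Suc n \<le> e n + q * ((cmod (d n))\<^sup>2 * t ^ n)" for n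
  proof (cases "n < N")
    case True
    have "(cmod (a (Suc n)))\<^sup>2 * t ^ Suc n \<le> (cmod (a (Suc n)))\<^sup>2 * 1"
      using t by (intro mult_left_mono power_le_one) auto
    moreover have "0 \<le> q * ((cmod (d n))\<^sup>2 * t ^ n)" using q t by auto
    ultimately show ?thesis using True by (simp add: e_def)
  next
    case False
    have "(cmod (a (Suc n)))\<^sup>2 * t ^ Suc n \<le> (q * (cmod (d n))\<^sup>2) * t ^ n"
      using False t q le[of n] by (intro mult_mono) (auto intro: mult_left_le_one_le)
    then show ?thesis using False by (simp add: e_def mult.assoc)
  qed
  have "coeff_mean a t = (cmod (a 0))\<^sup>2 + (\<Sum>n. (cmod (a (Suc n)))\<^sup>2 * t ^ Suc n)"
    unfolding coeff_mean_def using suminf_split_head[OF sa] by simp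
  also have "(\<Sum>n. (cmod (a (Suc n)))\<^sup>2 * t ^ Suc n) \<le> (\<Sum>n. e n + q * ((cmod (d n))\<^sup>2 * t ^ n))"
  proof (rule suminf_le[OF le'])
    show "summable (\<lambda>n. (cmod (a (Suc n)))\<^sup>2 * t ^ Suc n)"
      using sa by (subst summable_Suc_iff[of "\<lambda>n. (cmod (a n))\<^sup>2 * t ^ n"])
    show "summable (\<lambda>n. e n + q * ((cmod (d n))\<^sup>2 * t ^ n))"
      by (intro summable_add sums_summable[OF e] summable_mult sd)
  qed
  also have "\<dots> = (\<Sum>n<N. (cmod (a (Suc n)))\<^sup>2) + q * coeff_mean d t"
    unfolding coeff_mean_def using sums_add[OF e sums_mult[OF summable_sums[OF sd], of q]] by (simp add: sums_iff)
  finally show ?thesis by simp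
qed

text \<open>Dividing the density by \<open>q\<close> makes its norm at most 1 and gains
  \<open>q^2\<close> in the variance. One factor \<open>q\<close> pays for
  \<open>((n+1)/(n+2))^2\<close>, which is at least \<open>q\<close> for large \<open>n\<close>; the
  other remains in the result.\<close>

lemma bloch_asymptotic_variance_le_Sigma2:
  fixes a :: "nat \<Rightarrow> complex"
  assumes b: "\<And>z. z \<in> unit_disk \<Longrightarrow> (\<lambda>n. a n * z ^ n) sums b z" and hol: "b holomorphic_on unit_disk"
    and bd: "\<And>z. z \<in> unit_disk \<Longrightarrow> (1 - (cmod z)\<^sup>2) * cmod (deriv b z) \<le> 1"
    and S: "Sigma2 \<le> ereal S"
  shows "asymptotic_variance b \<le> ereal (9999/10000 * S)"
proof -
  define q :: real where "q = 9999/10000"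
  have q: "0 < q" "q < 1" by (auto simp: q_def)
  from bloch_representation[OF b hol bd] obtain \<mu> where \<mu>: "\<mu> \<in> borel_measurable (lebesgue_on unit_disk)"
    "\<And>w. w \<in> unit_disk \<Longrightarrow> cmod (\<mu> w) \<le> 1 - 1/10000"
    "\<And>z. z \<in> unit_disk \<Longrightarrow> (\<lambda>n. of_real (real (n + 1) / real (n + 2)) * a (Suc n) * z ^ n) sums bergman_projection \<mu> z"
    by blast
  define \<nu> where "\<nu> = (\<lambda>w. of_real (1 / q) * \<mu> w)"
  define d where "d = (\<lambda>n. of_real (1 / q) * (of_real (real (n + 1) / real (n + 2)) * a (Suc n)))"
  have \<nu>1: "cmod (\<nu> w) \<le> 1" if "w \<in> unit_disk" for w
    using \<mu>(2)[OF that] by (simp add: \<nu>_def norm_mult q_def)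
  have \<nu>m: "\<nu> \<in> borel_measurable (lebesgue_on unit_disk)" unfolding \<nu>_def using \<mu>(1) by (intro borel_measurable_times borel_measurable_const)
  have "Linfty_norm \<nu> \<le> 1" unfolding Linfty_norm_def
  proof (rule esssup_I)
    show "(\<lambda>w. ereal (cmod (\<nu> w))) \<in> borel_measurable (lebesgue_on unit_disk)" using \<nu>m by measurable
    show "AE w in lebesgue_on unit_disk. ereal (cmod (\<nu> w)) \<le> 1"
      by (rule AE_I2) (use \<nu>1 in \<open>auto simp: space_restrict_space\<close>)
  qed
  then have \<nu>in: "\<nu> \<in> {\<mu> \<in> Linfty_space. Linfty_norm \<mu> \<le> 1}"
    using \<nu>m by (auto simp: Linfty_space_def intro: order_le_less_trans)
  have "bergman_projection \<nu> z = of_real (1 / q) * bergman_projection \<mu> z" for z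
  proof -
    have "(\<lambda>w. \<nu> w / (1 - z * cnj w)\<^sup>2) = (\<lambda>w. of_real (1 / q) * (\<mu> w / (1 - z * cnj w)\<^sup>2))"
      unfolding \<nu>_def by (rule ext) (rule times_divide_eq_right[symmetric])
    then show ?thesis unfolding bergman_projection_def
      by (simp only: integral_mult_right_zero mult.left_commute)
  qed
  then have ds: "(\<lambda>n. d n * z ^ n) sums bergman_projection \<nu> z" if "z \<in> unit_disk" for z
    using sums_mult[OF \<mu>(3)[OF that], of "of_real (1 / q)"] by (simp only: d_def mult.assoc)
  have le: "(cmod (a (Suc n)))\<^sup>2 \<le> q * (cmod (d n))\<^sup>2" if n: "n \<ge> 20000" for n
  proof -
    \<comment> \<open>This holds as soon as \<open>n + 2 \<ge> 20000\<close>, whence the threshold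
      20000.\<close>
    have "q \<le> 1 - 2 / (real n + 2)" using n by (simp add: q_def field_simps)
    also have "\<dots> \<le> (1 - 1 / (real n + 2))\<^sup>2"
      by (simp add: power2_diff)
    also have "1 - 1 / (real n + 2) = (real n + 1) / (real n + 2)"
      by (simp add: field_simps)
    finally have "q * (cmod (a (Suc n)))\<^sup>2 \<le> ((real n + 1) / (real n + 2))\<^sup>2 * (cmod (a (Suc n)))\<^sup>2"
      by (rule mult_right_mono) simp
    moreover have "cmod (d n) = (real n + 1) / (real n + 2) * cmod (a (Suc n)) / q"
      using q unfolding d_def norm_mult norm_of_real by (simp add: add.commute mult.commute)
    moreover have "u\<^sup>2 \<le> q * (x * u / q)\<^sup>2" if "q * u\<^sup>2 \<le> x\<^sup>2 * u\<^sup>2" for x u :: real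
    proof -
      have "q * (x * u / q)\<^sup>2 = x\<^sup>2 * u\<^sup>2 / q" using q by (simp add: power2_eq_square)
      then show ?thesis using that q by (simp add: pos_le_divide_eq mult.commute)
    qed
    ultimately show ?thesis by (simp only:)
  qed
  define K where "K = (cmod (a 0))\<^sup>2 + (\<Sum>n<20000. (cmod (a (Suc n)))\<^sup>2)"
  have "asymptotic_variance (bergman_projection \<nu>) \<le> ereal S"
    using SUP_upper[OF \<nu>in, of "\<lambda>\<mu>. asymptotic_variance (bergman_projection \<mu>)"] S
    unfolding Sigma2_def by (rule order_trans)
  then have lim: "Limsup (at_left 1) (\<lambda>r. ereal (r * coeff_mean d (r\<^sup>2) / - ln (1 - r))) \<le> ereal S"
    by (subst (asm) asymptotic_variance_eq[OF ds])
  have "asymptotic_variance b \<le> ereal (q * (S + \<epsilon>))" if \<epsilon>: "\<epsilon> > 0" for \<epsilon>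
  proof (subst asymptotic_variance_eq[OF b], assumption, rule Limsup_le_if_log_error)
    have "\<forall>\<^sub>F r in at_left 1. ereal (r * coeff_mean d (r\<^sup>2) / - ln (1 - r)) < ereal (S + \<epsilon>)"
      using lim \<epsilon> by (intro Limsup_lessD) (auto intro: order_le_less_trans)
    moreover have "\<forall>\<^sub>F r in at_left 1. r \<in> {0<..<1::real}"
      by (rule eventually_at_leftI[of 0]) auto
    ultimately show "\<forall>\<^sub>F r in at_left 1. r * coeff_mean a (r\<^sup>2) / - ln (1 - r) \<le> q * (S + \<epsilon>) + K / - ln (1 - r)"
    proof eventually_elim
      case (elim r)
      then have r: "0 < r" "r < 1" by auto
      have r2: "0 \<le> r\<^sup>2" "r\<^sup>2 < 1" using r by (auto simp: power_less_one_iff)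
      define L where "L = - ln (1 - r)"
      have L: "L > 0" using r by (simp add: L_def)
      have "r * coeff_mean a (r\<^sup>2) \<le> r * (K + q * coeff_mean d (r\<^sup>2))"
        unfolding K_def using r q
        by (intro mult_left_mono coeff_mean_shift_le[OF sums_summable[OF b] sums_summable[OF ds] _ le r2]) auto
      also have "\<dots> \<le> K + q * (r * coeff_mean d (r\<^sup>2))"
      proof -
        have "r * K \<le> K" using r by (intro mult_left_le_one_le) (auto simp: K_def sum_nonneg)
        then show ?thesis by (simp add: algebra_simps)
      qed
      finally have "r * coeff_mean a (r\<^sup>2) / L \<le> (K + q * (r * coeff_mean d (r\<^sup>2))) / L"
        by (rule divide_right_mono) (use L in simp)
      also have "\<dots> = K / L + q * (r * coeff_mean d (r\<^sup>2) / L)" by (simp add: add_divide_distrib)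
      also have "\<dots> \<le> K / L + q * (S + \<epsilon>)"
        using elim(1) q by (intro add_left_mono mult_left_mono) (auto simp: L_def)
      finally show ?case by (simp add: L_def)
    qed
  qed
  note bound = this
  have "asymptotic_variance b \<le> ereal (q * S)"
  proof (rule ereal_le_epsilon2)
    fix e :: real assume "0 < e"
    then have "asymptotic_variance b \<le> ereal (q * (S + e))" by (rule bound)
    also have "\<dots> \<le> ereal (q * S) + ereal e"
      using q \<open>0 < e\<close> mult_left_le_one_le[of e q] by (simp add: algebra_simps)
    finally show "asymptotic_variance b \<le> ereal (q * S) + ereal e" .
  qed
  then show ?thesis by (simp add: q_def)
qed

section \<open>A lacunary series with positive asymptotic variance\<close>

lemma lacunary_sum_le:
  fixes r :: real
  assumes r: "0 \<le> r" "r \<le> 1"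
  shows "(\<Sum>k\<le>K. 2 ^ k * r ^ (2 ^ k)) \<le> 2 * (\<Sum>n=1..2^K. r ^ n)"
proof (induction K)
  case (Suc K)
  \<comment> \<open>Powers of \<open>r\<close> decrease, so each of the \<open>2^K\<close> exponents
    in the last dyadic block contributes at least \<open>r^(2^(K+1))\<close>. The block covers half
    of the new term, whence the factor 2.\<close>
  have "sum (\<lambda>_. r ^ (2 ^ Suc K)) {2^K+1..2^Suc K :: nat} \<le> (\<Sum>n=2^K+1..2^Suc K. r ^ n)"
    using r by (intro sum_mono power_decreasing) auto
  then have "2 ^ K * r ^ (2 ^ Suc K) \<le> (\<Sum>n=2^K+1..2^Suc K. r ^ n)" by simp
  moreover have "(\<Sum>n=1..2^Suc K. r ^ n) = (\<Sum>n=1..2^K. r ^ n) + (\<Sum>n=2^K+1..2^Suc K. r ^ n)"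
  proof -
    have "{1..2^Suc K} = {1..2^K} \<union> {2^K+1..2^Suc K::nat}" by auto
    then show ?thesis by (simp add: sum.union_disjoint)
  qed
  ultimately show ?case using Suc by simp
qed (use r in simp)

text \<open>The witness is 1/4 of the sum of \<open>z^(2^k)\<close>. Comparison with a geometric
  series gives \<open>|z b'(z)| \<le> r / (2 (1 - r))\<close> for \<open>r = |z|\<close>, hence
  Bloch norm at most 1. At \<open>r = 1 - 2^(-N)\<close> about \<open>N\<close> terms each add at
  least 1/32 to the mean of \<open>|b|^2\<close>, while \<open>- ln (1 - r) = N ln 2\<close>, so the
  ratio stays away from 0.\<close>

lemma lacunary_bloch:
  obtains b where "b holomorphic_on unit_disk"
    and "\<And>z. z \<in> unit_disk \<Longrightarrow> (1 - (cmod z)\<^sup>2) * cmod (deriv b z) \<le> 1"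
    and "asymptotic_variance b \<ge> ereal (1/256)"
proof
  define a :: "nat \<Rightarrow> complex" where "a = (\<lambda>n. if n \<in> range (\<lambda>k. 2 ^ k) then 1/4 else 0)"
  define b where "b = (\<lambda>z. \<Sum>n. a n * z ^ n)"
  have mono: "strict_mono (\<lambda>k. 2 ^ k :: nat)" by (rule strict_monoI) simp
  have na: "cmod (a n) \<le> 1" for n by (simp add: a_def)
  have s: "summable (\<lambda>n. a n * z ^ n)" if "cmod z < 1" for z
    by (rule summable_comparison_test'[OF summable_geometric[of "cmod z"]])
      (use that na in \<open>auto simp: norm_mult norm_power intro: mult_left_le_one_le\<close>)
  have bs: "(\<lambda>n. a n * z ^ n) sums b z" if "z \<in> unit_disk" for z
    unfolding b_def using s that by (auto intro: summable_sums)
  have der: "(b has_field_derivative (\<Sum>n. diffs a n * z ^ n)) (at z)" if "z \<in> unit_disk" for z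
    unfolding b_def by (rule termdiffs_strong'[of 1]) (use s that in auto)
  then show hol: "b holomorphic_on unit_disk"
    unfolding holomorphic_on_open[OF open_ball] by blast
  show "(1 - (cmod z)\<^sup>2) * cmod (deriv b z) \<le> 1" if z: "z \<in> unit_disk" for z
  \<comment> \<open>The series estimate concerns \<open>z * deriv b z\<close> and says nothing at
    0.\<close>
  proof (cases "z = 0")
    case True
    have "deriv b 0 = a 1"
      using DERIV_imp_deriv[OF der[of 0]] by (simp add: powser_zero diffs_def)
    moreover have "a 1 = 1/4" unfolding a_def by (auto intro!: image_eqI[of _ _ 0])
    ultimately have d: "deriv b 0 = 1/4" by simp
    show ?thesis unfolding True d by simp
  next
    case False
    define r where "r = cmod z"
    have r: "0 < r" "r < 1" using z False by (auto simp: r_def)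
    have sums: "(\<lambda>n. of_nat n * a n * z ^ n) sums (z * deriv b z)" by (rule disk_series_deriv(2)[OF bs z])
    then have lac: "(\<lambda>k. of_nat (2 ^ k) * a (2 ^ k) * z ^ (2 ^ k)) sums (z * deriv b z)"
      by (subst sums_mono_reindex[OF mono]) (auto simp: a_def)
    have "cmod (\<Sum>k<K. of_nat (2 ^ k) * a (2 ^ k) * z ^ (2 ^ k)) \<le> 1/2 * (r / (1 - r))" for K
    proof -
      have "cmod (\<Sum>k<K. of_nat (2 ^ k) * a (2 ^ k) * z ^ (2 ^ k)) \<le> (\<Sum>k<K. 1/4 * (2 ^ k * r ^ (2 ^ k)))"
        by (rule sum_norm_le) (simp add: a_def norm_mult norm_power r_def)
      also have "\<dots> \<le> 1/4 * (\<Sum>k\<le>K. 2 ^ k * r ^ (2 ^ k))"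
        unfolding sum_distrib_left using r by (intro sum_mono2) auto
      also have "\<dots> \<le> 1/4 * (2 * (\<Sum>n=1..2^K. r ^ n))"
        using r by (intro mult_left_mono lacunary_sum_le) auto
      also have "(\<Sum>n=1..2^K. r ^ n) \<le> (\<Sum>n. r ^ Suc n)"
      proof -
        have "(\<Sum>n=1..2^K. r ^ n) = (\<Sum>n<2^K. r ^ Suc n)"
          by (rule sum.reindex_bij_witness[of _ Suc "\<lambda>n. n - 1"]) auto
        also have "\<dots> \<le> (\<Sum>n. r ^ Suc n)"
          using r summable_mult[OF summable_geometric[of r], of r] by (intro sum_le_suminf) auto
        finally show ?thesis .
      qed
      also have "(\<Sum>n. r ^ Suc n) = r / (1 - r)"
        using sums_mult[OF geometric_sums[of r], of r] r by (simp add: sums_iff)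
      finally show ?thesis by simp
    qed
    then have "cmod (z * deriv b z) \<le> 1/2 * (r / (1 - r))"
      using lac[unfolded sums_def] by (intro Lim_bounded[OF tendsto_norm]) auto
    then have "r * cmod (deriv b z) * (1 - r) \<le> r * (1/2)"
      using r by (simp add: norm_mult r_def[symmetric] field_simps)
    then have *: "cmod (deriv b z) * (1 - r) \<le> 1/2" using r by (simp add: mult.assoc)
    have "(1 - r\<^sup>2) * cmod (deriv b z) = (1 + r) * (cmod (deriv b z) * (1 - r))"
      by (simp add: power2_eq_square algebra_simps)
    also have "\<dots> \<le> 2 * (1/2)" using * r by (intro mult_mono) auto
    finally show ?thesis by (simp add: r_def)
  qed
  have low: "coeff_mean a (r\<^sup>2) \<ge> real (N - 1) / 32" if r: "r = 1 - (1/2) ^ N" and N: "N \<ge> 2" for r :: real and N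
  proof -
    have r01: "0 \<le> r" "r < 1" using r by (auto simp: power_le_one)
    have r2: "0 \<le> r\<^sup>2" "r\<^sup>2 < 1" using r01 by (auto simp: power_less_one_iff)
    have "(\<lambda>n. (cmod (a n))\<^sup>2 * (r\<^sup>2) ^ n) sums coeff_mean a (r\<^sup>2)"
      unfolding coeff_mean_def by (intro summable_sums coeff_mean_summable r2 s) auto
    then have lac: "(\<lambda>k. (cmod (a (2 ^ k)))\<^sup>2 * (r\<^sup>2) ^ (2 ^ k)) sums coeff_mean a (r\<^sup>2)"
      by (subst sums_mono_reindex[OF mono]) (auto simp: a_def)
    have "real (N - 1) / 32 = (\<Sum>k<N - 1. 1/32)" by simp
    also have "\<dots> \<le> (\<Sum>k<N - 1. (cmod (a (2 ^ k)))\<^sup>2 * (r\<^sup>2) ^ (2 ^ k))"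
    proof (rule sum_mono)
      fix k assume "k \<in> {..<N - 1}"
      then have k: "Suc (Suc k) \<le> N" by auto
      \<comment> \<open>For \<open>k + 2 \<le> N\<close> Bernoulli gives
        \<open>r^(2^(k+1)) \<ge> 1 - 2^(k+1-N) \<ge> 1/2\<close>; times the squared coefficient 1/16
        this is 1/32.\<close>
      have "1 + real (2 ^ Suc k) * (- ((1/2) ^ N)) \<le> (1 + - ((1/2) ^ N)) ^ (2 ^ Suc k)"
        by (rule Bernoulli_inequality) (simp add: power_le_one)
      moreover have "real (2 ^ Suc k) * (1/2) ^ N \<le> real (2 ^ Suc k) * (1/2) ^ Suc (Suc k)"
        using k by (intro mult_left_mono power_decreasing) auto
      then have "real (2 ^ Suc k) * (1/2) ^ N \<le> 1/2" by (simp add: power_one_over)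
      ultimately have "1/2 \<le> r ^ (2 ^ Suc k)" using r by simp
      also have "r ^ (2 ^ Suc k) = (r\<^sup>2) ^ (2 ^ k)" by (simp add: power_mult)
      finally show "1/32 \<le> (cmod (a (2 ^ k)))\<^sup>2 * (r\<^sup>2) ^ (2 ^ k)"
        by (simp add: a_def power2_eq_square)
    qed
    also have "\<dots> \<le> coeff_mean a (r\<^sup>2)"
      using lac r2 by (subst sums_unique[OF lac]) (intro sum_le_suminf, auto simp: sums_iff)
    finally show ?thesis .
  qed
  define R where "R = (\<lambda>N. 1 - (1/2) ^ N :: real)"
  have R: "filterlim R (at_left 1) sequentially"
    unfolding filterlim_at
  proof
    show "\<forall>\<^sub>F N in sequentially. R N \<in> {..<1} \<and> R N \<noteq> 1" by (simp add: R_def)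
    have "R \<longlonglongrightarrow> 1 - 0" unfolding R_def by (intro tendsto_diff tendsto_const LIMSEQ_realpow_zero) auto
    then show "R \<longlonglongrightarrow> 1" by simp
  qed
  show "asymptotic_variance b \<ge> ereal (1/256)"
  proof (rule ccontr)
    assume "\<not> ereal (1/256) \<le> asymptotic_variance b"
    then have "asymptotic_variance b < ereal (1/256)" by (simp only: not_le)
    then have "Limsup (at_left 1) (\<lambda>r. ereal (r * coeff_mean a (r\<^sup>2) / - ln (1 - r))) < ereal (1/256)"
      by (subst (asm) asymptotic_variance_eq[OF bs])
    then have "\<forall>\<^sub>F r in at_left 1. ereal (r * coeff_mean a (r\<^sup>2) / - ln (1 - r)) < ereal (1/256)"
      by (rule Limsup_lessD)
    then have "\<forall>\<^sub>F r in at_left 1. r * coeff_mean a (r\<^sup>2) / - ln (1 - r) < 1/256" by simp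
    from eventually_compose_filterlim[OF this R]
    have "\<forall>\<^sub>F N in sequentially. R N * coeff_mean a ((R N)\<^sup>2) / - ln (1 - R N) < 1/256" .
    then obtain N where N: "N \<ge> 2" and lt: "R N * coeff_mean a ((R N)\<^sup>2) / - ln (1 - R N) < 1/256"
      unfolding eventually_sequentially by (metis nat_le_linear)
    have "(1/2 :: real) ^ N \<le> (1/2) ^ 1" using N by (intro power_decreasing) auto
    then have half: "1/2 \<le> R N" by (simp add: R_def)
    have L: "- ln (1 - R N) = real N * ln 2" by (simp add: R_def ln_realpow ln_div)
    have "real N / 128 \<le> 1/2 * (real (N - 1) / 32)" using N by (simp add: of_nat_diff)
    also have "\<dots> \<le> R N * coeff_mean a ((R N)\<^sup>2)"
      using half low[of "R N" N] N by (intro mult_mono) (auto simp: R_def)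
    finally have "real N / 128 \<le> R N * coeff_mean a ((R N)\<^sup>2)" .
    also have "\<dots> < 1/256 * (real N * ln 2)"
      using lt N unfolding L by (simp add: field_simps)
    also have "\<dots> \<le> 1/256 * (real N * 1)" using ln_2_less_1 by (intro mult_left_mono) auto
    finally show False using N by simp
  qed
qed

theorem theorem1p2:
  shows "Sigma2_Bloch < min (ereal 0.9) Sigma2"
proof -
  have series: "(\<lambda>n. (deriv ^^ n) b 0 / fact n * z ^ n) sums b z"
    if "b holomorphic_on unit_disk" "z \<in> unit_disk" for b z
    using holomorphic_power_series[OF that] by simp
  have upper: "Sigma2_Bloch \<le> ereal c"
    if c: "\<And>b. b holomorphic_on unit_disk \<Longrightarrow> (\<And>z. z \<in> unit_disk \<Longrightarrow> (1 - (cmod z)\<^sup>2) * cmod (deriv b z) \<le> 1)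
        \<Longrightarrow> asymptotic_variance b \<le> ereal c" for c
    unfolding Sigma2_Bloch_def
  proof (rule SUP_least)
    fix b assume "b \<in> {b \<in> bloch_space. bloch_norm b \<le> 1}"
    then have "b holomorphic_on unit_disk" "bloch_norm b \<le> 1" by (auto simp: bloch_space_def)
    then show "asymptotic_variance b \<le> ereal c" by (intro c bloch_norm_le_1D)
  qed
  have u1: "Sigma2_Bloch \<le> ereal (177/200)"
    by (rule upper) (rule bloch_asymptotic_variance_le[OF series])
  have u2: "Sigma2_Bloch \<le> ereal (9999/10000 * S)" if "Sigma2 \<le> ereal S" for S
    by (rule upper) (rule bloch_asymptotic_variance_le_Sigma2[OF series _ _ that])
  have low: "Sigma2_Bloch \<ge> ereal (1/256)"
  proof -
    obtain b where b: "b holomorphic_on unit_disk"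
      "\<And>z. z \<in> unit_disk \<Longrightarrow> (1 - (cmod z)\<^sup>2) * cmod (deriv b z) \<le> 1"
      "asymptotic_variance b \<ge> ereal (1/256)" using lacunary_bloch by blast
    have n1: "bloch_norm b \<le> 1"
      unfolding bloch_norm_def using b(2) by (intro SUP_least) simp
    then have "b \<in> {b \<in> bloch_space. bloch_norm b \<le> 1}"
      using b(1) by (auto simp: bloch_space_def intro: order_le_less_trans)
    then have "asymptotic_variance b \<le> Sigma2_Bloch" unfolding Sigma2_Bloch_def by (rule SUP_upper)
    with b(3) show ?thesis by (rule order_trans)
  qed
  have "Sigma2_Bloch < Sigma2"
  \<comment> \<open>For finite \<open>S\<close> the bound \<open>9999/10000 * S\<close> is strictly
    below \<open>S\<close> only if \<open>S > 0\<close>, which \<open>low\<close> provides. An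
    infinite \<open>Sigma2\<close> is handled by \<open>u1\<close>, and minus infinity contradicts
    \<open>low\<close>.\<close>
  proof (cases Sigma2)
    case (real S)
    then have le: "Sigma2_Bloch \<le> ereal (9999/10000 * S)" by (intro u2) simp
    with low have "ereal (1/256) \<le> ereal (9999/10000 * S)" by (rule order_trans)
    then have "9999/10000 * S < S" by simp
    then have "ereal (9999/10000 * S) < Sigma2" unfolding real less_ereal.simps .
    then show ?thesis by (rule order_le_less_trans[OF le])
  next
    case PInf
    then show ?thesis using u1 by (auto intro: order_le_less_trans)
  next
    case MInf
    have "Sigma2 \<le> ereal 0" unfolding MInf by simp
    then have "Sigma2_Bloch \<le> ereal (9999/10000 * 0)" by (rule u2)
    with low have "ereal (1/256) \<le> ereal (9999/10000 * 0)" by (rule order_trans)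
    then show ?thesis by simp
  qed
  moreover have "Sigma2_Bloch < ereal 0.9" using u1 by (rule order_le_less_trans) simp
  ultimately show ?thesis by simp
qed

end
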